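(* Let $f:\mathbb{C}\to\mathbb{C}$ be holomorphic and let $z_0\neq z_1$ be two (neighbored) centers of the flow $\dot z(t)=f(z(t))$ (real time $t$). For $i\in\{0,1\}$ let $$P_i:=\{z_i\}\cup\{z^*\in\mathbb{C} : \text{the solution of } \dot z=f(z) \text{ with } z(0)=z^* \text{ is a periodic orbit around } z_i\}.$$ Suppose that $P_0$ and $P_1$ have a common boundary component, in the sense that there is an open set $U\subseteq\mathbb{C}$ with $$C:=\partial P_0\cap\partial P_1\cap U\neq\emptyset.$$ Then for every $z^*\in U$ the following are equivalent: (1) $z^*\in C$; (2) for all sufficiently small $\varepsilon>0$ there exist points $z_i^*\in U_\varepsilon(z^* )\cap P_i$, $i\in\{0,1\}$, such that the orbits $\gamma_i$ of the flow $\dot z=f(z)$ with $z(0)=z_i^*$ satisfy $$\operatorname{ind}_{\gamma_0}(z_0)\cdot\operatorname{ind}_{\gamma_1}(z_1)=-1.$$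
   Context: The flow of $f$ is the real-time autonomous system $\dot z(t)=f(z(t))$ on $\mathbb{C}\cong\mathbb{R}^2$. A center is an equilibrium $z_i$ (i.e. $f(z_i)=0$) having a punctured neighborhood filled with non-constant periodic orbits surrounding $z_i$. A periodic orbit around $z_i$ is a non-constant periodic solution whose closed trajectory encloses $z_i$. The centers are called neighbored in the sense that their regions $P_0,P_1$ share a boundary part $C$ as in the claim. $U_\varepsilon(z^* )$ denotes the open disc of radius $\varepsilon$ about $z^*$, and $\partial$ denotes the topological boundary in $\mathbb{C}$. For a non-constant periodic orbit $\gamma$ traversed once (over one minimal period) in the direction of increasing time, and a point $w\notin\gamma$, $\operatorname{ind}_\gamma(w)\in\mathbb{Z}$ is the index (winding number) of $\gamma$ about $w$, counted positively in the mathematically positive (counterclockwise) sense. The index condition in (2) includes that $\gamma_0$ and $\gamma_1$ are non-constant periodic orbits, so $z_i^*\neq z_i$. *)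

theory Defs
  imports "HOL-Complex_Analysis.Complex_Analysis"
begin

text \<open>Solutions of \<open>z' = f(z)\<close> that exist for all real time; periodic solutions are always of
  this kind. For holomorphic \<open>f\<close> a solution is determined by its value at time 0.\<close>

definition global_solution :: "(complex \<Rightarrow> complex) \<Rightarrow> (real \<Rightarrow> complex) \<Rightarrow> bool" where
  "global_solution f \<gamma> \<longleftrightarrow> (\<forall>t. (\<gamma> has_vector_derivative f (\<gamma> t)) (at t))"

definition is_period :: "(real \<Rightarrow> complex) \<Rightarrow> real \<Rightarrow> bool" where
  "is_period \<gamma> T \<longleftrightarrow> T > 0 \<and> (\<forall>t. \<gamma> (t + T) = \<gamma> t)"

definition periodic_orbit :: "(complex \<Rightarrow> complex) \<Rightarrow> (real \<Rightarrow> complex) \<Rightarrow> bool" where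
  "periodic_orbit f \<gamma> \<longleftrightarrow>
     global_solution f \<gamma> \<and> (\<exists>T. is_period \<gamma> T) \<and> \<not> \<gamma> constant_on UNIV"

text \<open>The trajectory encloses \<open>c\<close>: \<open>c\<close> lies in a bounded component of its complement.\<close>

definition periodic_orbit_around ::
    "(complex \<Rightarrow> complex) \<Rightarrow> (real \<Rightarrow> complex) \<Rightarrow> complex \<Rightarrow> bool" where
  "periodic_orbit_around f \<gamma> c \<longleftrightarrow> periodic_orbit f \<gamma> \<and> c \<in> inside (range \<gamma>)"

definition is_center :: "(complex \<Rightarrow> complex) \<Rightarrow> complex \<Rightarrow> bool" where
  "is_center f c \<longleftrightarrow>
     f c = 0 \<and>
     (\<exists>r>0. \<forall>w \<in> ball c r - {c}. \<exists>\<gamma>. periodic_orbit_around f \<gamma> c \<and> \<gamma> 0 = w)"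

definition center_region :: "(complex \<Rightarrow> complex) \<Rightarrow> complex \<Rightarrow> complex set" where
  "center_region f c = {c} \<union> {w. \<exists>\<gamma>. periodic_orbit_around f \<gamma> c \<and> \<gamma> 0 = w}"

text \<open>The least period exists for every non-constant continuous periodic function.\<close>

definition minimal_period :: "(real \<Rightarrow> complex) \<Rightarrow> real" where
  "minimal_period \<gamma> = (LEAST T. is_period \<gamma> T)"

text \<open>The orbit is run through once in the direction of increasing time, rescaled to the
  parameter interval \<open>[0,1]\<close> on which \<^const>\<open>winding_number\<close> is defined.\<close>

definition orbit_index :: "(real \<Rightarrow> complex) \<Rightarrow> complex \<Rightarrow> complex" where
  "orbit_index \<gamma> w = winding_number (\<lambda>s. \<gamma> (s * minimal_period \<gamma>)) w"

end

theory Submission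
  imports Defs
begin

text \<open>
  The equivalence has an easy and a hard half. If \<open>P0\<close> and \<open>P1\<close> are open and disjoint, then a
  point that both regions approach lies in neither of them, hence on both boundaries; this gives
  (2) \<open>\<Longrightarrow>\<close> (1). For (1) \<open>\<Longrightarrow>\<close> (2) one has to know that at a common boundary point the two
  regions rotate in opposite directions.

  Everything rests on one fact about a single periodic orbit \<open>\<gamma>\<close> with a zero \<open>c\<close> of \<open>f\<close> inside it:
  a neighbourhood of the closed disc bounded by \<open>\<gamma>\<close> is the biholomorphic image under a chart \<open>k\<close>
  of a round disc on which the flow is the rotation \<open>w' = \<lambda>w\<close>, where \<open>\<lambda> = f'(c)\<close>
  (\<open>linearizing_chart_around_orbit\<close>). To see this, first apply Hopf's Umlaufsatz: the tangent
  \<open>\<gamma>' = f \<circ> \<gamma>\<close> turns once around \<open>0\<close>, so by the argument principle \<open>c\<close> is the only zero of \<open>f\<close>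
  inside \<open>\<gamma>\<close> and is simple. Hence \<open>\<lambda>/f\<close> has a single pole, with residue \<open>1\<close>, in a simply
  connected neighbourhood of the disc, and \<open>h = exp (\<integral> \<lambda>/f)\<close> is a holomorphic function there with
  \<open>h' f = \<lambda> h\<close>. Along \<open>\<gamma>\<close> it satisfies \<open>h(\<gamma>(t)) = h(\<gamma>(0)) e\<^sup>\<lambda>\<^sup>t\<close>. The integral of \<open>\<lambda>/f\<close> over \<open>\<gamma>\<close>
  is \<open>\<lambda>T\<close> for the minimal period \<open>T\<close> and also \<open>2\<pi>\<i>\<close> times the index of \<open>\<gamma>\<close>, which is \<open>1\<close> or
  \<open>-1\<close>. So \<open>\<lambda>\<close> is imaginary, \<open>h\<close> maps \<open>\<gamma>\<close> bijectively to a circle, and by the argument principle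
  it maps the inside bijectively to the disc; \<open>k\<close> is its inverse.

  The chart has these consequences. All points of the chart domain lie in the region, so regions of
  centers are open. The index of every orbit in the region is the sign of \<open>Im \<lambda>\<close>. An orbit encloses
  only one zero, so the regions of different centers are disjoint. All orbits of a region have the
  same period, so a zero of \<open>f\<close> on the boundary would force whole orbits close to the boundary zero to
  stay near it, although they enclose \<open>c\<close>; the boundary therefore contains no zeros
  (\<open>field_nonzero_on_frontier\<close>).

  Finally let \<open>z\<close> lie on both boundaries. Since \<open>f z \<noteq> 0\<close>, there is a local solution \<open>g\<close> of
  \<open>g' = f \<circ> g\<close>, \<open>g 0 = z\<close> in complex time \<open>\<zeta>\<close>. In the chart, complex time acts as
  \<open>w \<mapsto> w e\<^sup>\<lambda>\<^sup>\<zeta>\<close>, which does not increase \<open>\<bar>w\<bar>\<close> as long as \<open>Im \<lambda> \<cdot> Im \<zeta> \<ge> 0\<close>. So from a point of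
  a region close to \<open>z\<close> one never leaves the region when moving in this half plane of times. If
  both multipliers had imaginary parts of the same sign, the two regions would in this way reach a
  common point, contradicting disjointness (\<open>neighbouring_centers_rotate_oppositely\<close>).
\<close>

section \<open>Periodic functions\<close>

lemma is_period_of_int:
  assumes "is_period \<gamma> T"
  shows "\<gamma> (t + of_int n * T) = \<gamma> t"
proof -
  have nat: "\<gamma> (t + of_nat n * T) = \<gamma> t" for t n
  proof (induction n)
    case (Suc n)
    have "\<gamma> (t + of_nat (Suc n) * T) = \<gamma> (t + of_nat n * T + T)" by (simp add: algebra_simps)
    then show ?case using Suc assms by (simp add: is_period_def)
  qed simp
  show ?thesis
  proof (cases n rule: int_cases2)
    case (nonneg k) then show ?thesis using nat by simp
  next
    case (nonpos k) then show ?thesis using nat[of "t - of_nat k * T" k] by simp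
  qed
qed

lemma is_period_frac:
  assumes "is_period \<gamma> T"
  shows "\<gamma> t = \<gamma> (frac (t / T) * T)"
proof -
  have "t = frac (t / T) * T + of_int \<lfloor>t / T\<rfloor> * T"
    using assms by (simp add: is_period_def frac_def field_simps)
  then show ?thesis using is_period_of_int[OF assms] by metis
qed

section \<open>Hopf's Umlaufsatz\<close>

text \<open>The difference takes values in the discrete set \<open>2\<pi>\<i>\<int>\<close>, so it is locally constant.\<close>

lemma continuous_logarithms_differ_by_constant:
  fixes a b :: "'a::topological_space \<Rightarrow> complex"
  assumes "connected S" "continuous_on S a" "continuous_on S b"
    and eq: "\<And>x. x \<in> S \<Longrightarrow> exp (a x) = exp (b x)" and "x \<in> S" "y \<in> S"
  shows "a x - b x = a y - b y"
proof -
  have "(\<lambda>x. a x - b x) constant_on S"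
  proof (rule continuous_discrete_range_constant)
    show "connected S" "continuous_on S (\<lambda>x. a x - b x)"
      using assms by (auto intro: continuous_intros)
    fix x assume x: "x \<in> S"
    have "2 * pi \<le> norm ((a y - b y) - (a x - b x))" if y: "y \<in> S" "a y - b y \<noteq> a x - b x" for y
    proof -
      obtain m n :: int where "a x = b x + (of_int (2*m) * pi) * \<i>" "a y = b y + (of_int (2*n) * pi) * \<i>"
        using eq[OF x] eq[OF y(1)] exp_eq by metis
      then have d: "(a y - b y) - (a x - b x) = of_real (2 * pi * of_int (n - m)) * \<i>"
        by (simp add: algebra_simps)
      with y have "n \<noteq> m" by auto
      then have "1 \<le> \<bar>real_of_int (n - m)\<bar>" by linarith
      then show ?thesis
        unfolding d norm_mult norm_of_real by (simp add: abs_mult)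
    qed
    then show "\<exists>e>0. \<forall>y. y \<in> S \<and> a y - b y \<noteq> a x - b x \<longrightarrow> e \<le> norm ((a y - b y) - (a x - b x))"
      by (intro exI[of _ "2*pi"]) auto
  qed
  then obtain c where "\<And>x. x \<in> S \<Longrightarrow> a x - b x = c"
    unfolding constant_on_def by blast
  then show ?thesis using assms(5,6) by simp
qed

text \<open>Hopf's proof. The chord directions \<open>p (s + u) - p s\<close> for \<open>0 < u < 1\<close> never vanish, and after
  division by \<open>u (1 - u)\<close> they extend continuously to the strip \<open>0 \<le> u \<le> 1\<close>, with the boundary
  values \<open>v s\<close> at \<open>u = 0\<close> and \<open>- v s\<close> at \<open>u = 1\<close>. The strip is contractible, so the extension \<open>H\<close>
  has a continuous logarithm there, and its change along \<open>u = 0\<close> over one period can be measured along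
  a detour through \<open>u = 1\<close>. The detour starts at a lowest point \<open>p t0\<close> of the curve and uses only
  chords with one end at this point. Each of its two halves thus stays in a closed half plane, and its
  angle changes by \<open>\<pi>\<close> in absolute value, with the same sign for both halves.\<close>

theorem umlaufsatz:
  fixes p v :: "real \<Rightarrow> complex"
  assumes der: "\<And>t. (p has_vector_derivative v t) (at t)"
    and contv: "continuous_on UNIV v" and vnz: "\<And>t. v t \<noteq> 0"
    and per: "\<And>t. p (t + 1) = p t"
    and simple: "\<And>s u. 0 < u \<Longrightarrow> u < 1 \<Longrightarrow> p (s + u) \<noteq> p s"
  shows "norm (winding_number v 0) = 1"
proof -
  have contp: "continuous_on A p" for A
    using der by (meson continuous_at_imp_continuous_on has_vector_derivative_continuous)
  have perv: "v (t + 1) = v t" for t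
  proof -
    have "((\<lambda>t. p (t + 1)) has_vector_derivative v (t + 1)) (at t)"
      using vector_diff_chain_at[of "\<lambda>t. t + 1" 1 t p "v (t + 1)"] der[of "t + 1"]
      by (simp add: o_def has_vector_derivative_add_const)
    then show ?thesis
      using der[of t] by (simp add: per vector_derivative_unique_at)
  qed
  \<comment> \<open>the difference quotient, in a form that is visibly continuous also at \<open>u = 0\<close>\<close>
  define D where "D = (\<lambda>s u. integral (cbox 0 1) (\<lambda>x. v (s + x * u)))"
  have D: "of_real u * D s u = p (s + u) - p s" for s u
  proof -
    have "((\<lambda>x. u *\<^sub>R v (s + x * u)) has_integral (p (s + 1 * u) - p (s + 0 * u))) {0..1}"
    proof (rule fundamental_theorem_of_calculus)
      fix x :: real
      have "((\<lambda>x. s + x * u) has_vector_derivative u) (at x)"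
        by (auto intro!: derivative_eq_intros)
      from vector_diff_chain_at[OF this der]
      show "((\<lambda>x. p (s + x * u)) has_vector_derivative u *\<^sub>R v (s + x * u)) (at x within {0..1})"
        by (simp add: o_def has_vector_derivative_at_within)
    qed simp
    then show ?thesis
      unfolding D_def by (simp add: integral_unique scaleR_conv_of_real[symmetric] flip: integral_cmul)
  qed
  have contD: "continuous_on UNIV (\<lambda>z. D (fst z) (snd z))"
    unfolding D_def
    by (rule integral_continuous_on_param)
       (auto simp: case_prod_unfold intro!: continuous_intros continuous_on_compose2[OF contv])
  have D0: "D s 0 = v s" for s
    by (simp add: D_def)
  \<comment> \<open>the two formulas agree for \<open>0 < u < 1\<close>: there both are the chord divided by \<open>u (1 - u)\<close>\<close>
  define H where "H = (\<lambda>z. if snd z < 1 then D (fst z) (snd z) / of_real (1 - snd z)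
                              else - D (fst z + snd z) (1 - snd z) / of_real (snd z))"
  have H_mid: "H (s, u) = (p (s + u) - p s) / of_real (u * (1 - u))" if "0 < u" "u < 1" for s u
  proof -
    have "D s u = (p (s + u) - p s) / of_real u"
      using that D[of u s] by (metis less_irrefl nonzero_mult_div_cancel_left of_real_eq_0_iff)
    then show ?thesis using that by (simp add: H_def)
  qed
  have H_pos: "H (s, u) = - D (s + u) (1 - u) / of_real u" if "0 < u" for s u
  proof (cases "u < 1")
    case True
    have "of_real (1 - u) * D (s + u) (1 - u) = p s - p (s + u)"
      using D[of "1 - u" "s + u"] per[of s] by simp
    then have "D (s + u) (1 - u) = (p s - p (s + u)) / of_real (1 - u)"
      using True by (metis diff_gt_0_iff_gt less_irrefl nonzero_mult_div_cancel_left of_real_eq_0_iff)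
    then show ?thesis
      using that True by (simp add: H_mid[OF that True]) (simp add: divide_simps)
  qed (simp add: H_def)
  have contH: "continuous_on UNIV H"
  proof -
    let ?A = "{z :: real \<times> real. snd z < 1}" and ?B = "{z :: real \<times> real. 0 < snd z}"
    have "continuous_on (?A \<union> ?B) H"
    proof (rule continuous_on_open_Un)
      show "open ?A" "open ?B"
        by (intro open_Collect_less continuous_intros)+
      have "continuous_on ?A (\<lambda>z. D (fst z) (snd z) / of_real (1 - snd z))"
        by (intro continuous_intros continuous_on_subset[OF contD]) auto
      then show "continuous_on ?A H"
        by (rule continuous_on_eq) (simp add: H_def)
      have "continuous_on ?B (\<lambda>z. - D (fst z + snd z) (1 - snd z) / of_real (snd z))"
        by (intro continuous_intros continuous_on_compose2[OF contD, of _ "\<lambda>z. (fst z + snd z, 1 - snd z)", simplified]) auto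
      then show "continuous_on ?B H"
        by (rule continuous_on_eq) (use H_pos in auto)
    qed
    moreover have "?A \<union> ?B = UNIV" by auto
    ultimately show ?thesis by simp
  qed
  have H0: "H (s, 0) = v s" and H1: "H (s, 1) = - v s" for s
    by (simp_all add: H_def D0 perv)
  have Hnz: "H z \<noteq> 0" if "z \<in> UNIV \<times> {0..1}" for z
  proof -
    obtain s u where z: "z = (s, u)" by (cases z)
    with that have u: "0 \<le> u" "u \<le> 1" by auto
    consider "u = 0" | "u = 1" | "0 < u" "u < 1" using u by linarith
    then show ?thesis
      using simple[of u s] unfolding z by cases (auto simp: H0 H1 vnz H_mid)
  qed
  have "continuous_on (UNIV \<times> {0..1}) H"
    using contH continuous_on_subset by blast
  moreover have "contractible ((UNIV :: real set) \<times> {0..1::real})"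
    by (intro convex_imp_contractible convex_Times) auto
  ultimately have "\<exists>g. continuous_on (UNIV \<times> {0..1}) g \<and> (\<forall>z\<in>UNIV \<times> {0..1}. H z = exp (g z))"
    using Hnz continuous_logarithm_on_contractible[of "UNIV \<times> {0..1}" H] by metis
  then obtain g where contg: "continuous_on (UNIV \<times> {0..1}) g"
    and g: "\<And>z. z \<in> UNIV \<times> {0..1} \<Longrightarrow> H z = exp (g z)"
    by blast
  have contg': "continuous_on A (\<lambda>x. g (h x))"
    if "continuous_on A h" "h ` A \<subseteq> UNIV \<times> {0..1}" for A :: "real set" and h
    using continuous_on_compose2[OF contg that] .
  obtain t0 where t0: "\<And>t. Im (p t0) \<le> Im (p t)"
  proof -
    obtain t0 where t0: "t0 \<in> {0..1}" "\<And>t. t \<in> {0..1} \<Longrightarrow> Im (p t0) \<le> Im (p t)"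
    proof -
      have "continuous_on {0..1} (\<lambda>t. Im (p t))"
        by (intro continuous_intros contp)
      from continuous_attains_inf[OF _ _ this] show ?thesis
        using that by fastforce
    qed
    have frac: "p t = p (frac t)" for t
      using is_period_frac[of p 1 t] per by (simp add: is_period_def)
    have "Im (p t0) \<le> Im (p t)" for t
      using t0(2)[of "frac t"] frac[of t] frac_ge_0[of t] frac_lt_1[of t] by auto
    then show ?thesis using that by blast
  qed
  define a where "a = v t0"
  have Ima: "Im a = 0"
  proof -
    have "((\<lambda>t. Im (p t)) has_real_derivative Im a) (at t0)"
      using der[of t0] bounded_linear.has_vector_derivative[OF bounded_linear_Im]
      by (auto simp: a_def has_real_derivative_iff_has_vector_derivative)
    then show ?thesis
      by (rule DERIV_local_min[of _ _ _ 1]) (use t0 in auto)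
  qed
  have Rea: "Re a \<noteq> 0" using vnz[of t0] Ima by (auto simp: a_def complex_eq_iff)
  \<comment> \<open>a logarithm whose branch cut is the negative imaginary axis, hence continuous on the closed upper half plane without \<open>0\<close>\<close>
  define L where "L = (\<lambda>z. Ln (- \<i> * z) + \<i> * of_real pi / 2)"
  have expL: "exp (L z) = z" if "z \<noteq> 0" for z
  proof -
    have "exp (\<i> * of_real pi / 2) = \<i>"
      using cis_conv_exp[of "pi / 2"] by simp
    moreover have "- (\<i> * z * \<i>) = z" by (simp add: complex_eq_iff)
    ultimately show ?thesis using that by (simp add: L_def exp_add)
  qed
  have contL: "continuous_on {z. 0 \<le> Im z \<and> z \<noteq> 0} L"
    unfolding L_def
    by (intro continuous_intros) (auto simp: complex_nonpos_Reals_iff complex_eq_iff)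
  have jump: "L (- a) - L a = \<i> * of_real (sgn (Re a) * pi)"
  proof -
    have "a = of_real (Re a)" using Ima by (simp add: complex_eq_iff)
    then obtain r where r: "a = of_real r" "r \<noteq> 0" using Rea by auto
    have "Ln (\<i> * of_real r) - Ln (- \<i> * of_real r) = \<i> * of_real (sgn r * pi)"
    proof (cases "r > 0")
      case True
      then show ?thesis
        using Ln_times_of_real[of r "\<i>"] Ln_times_of_real[of r "-\<i>"] by (simp add: mult.commute)
    next
      case False
      then have "0 < - r" using r by simp
      then show ?thesis
        using Ln_times_of_real[of "-r" "\<i>"] Ln_times_of_real[of "-r" "-\<i>"] r by (simp add: mult.commute)
    qed
    then show ?thesis by (simp add: L_def r)
  qed
  have upper1: "0 \<le> Im (H (t0, u))" if u: "u \<in> {0..1}" for u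
  proof -
    consider "u = 0" | "u = 1" | "0 < u" "u < 1" using u by fastforce
    then show ?thesis
      using t0[of "t0 + u"] Ima by cases (auto simp: H0 H1 H_mid a_def Im_divide_of_real simp del: of_real_mult)
  qed
  have upper2: "0 \<le> Im (- H (t0 + 1 - u, u))" if u: "u \<in> {0..1}" for u
  proof -
    consider "u = 0" | "u = 1" | "0 < u" "u < 1" using u by fastforce
    then show ?thesis
      using t0[of "t0 + 1 - u"] Ima per[of t0]
      by cases (auto simp: H0 H1 H_mid a_def perv Im_divide_of_real divide_nonpos_pos simp del: of_real_mult)
  qed
  \<comment> \<open>first half of the detour: chords from the lowest point to the other points\<close>
  have edge1: "g (t0, 1) - L (- a) = g (t0, 0) - L a"
  proof -
    have "g (t0, 1) - L (H (t0, 1)) = g (t0, 0) - L (H (t0, 0))"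
    proof (rule continuous_logarithms_differ_by_constant[of "{0..1::real}" "\<lambda>u. g (t0, u)" "\<lambda>u. L (H (t0, u))"])
      show "continuous_on {0..1} (\<lambda>u. g (t0, u))"
        by (rule contg') (auto intro!: continuous_intros)
      show "continuous_on {0..1} (\<lambda>u. L (H (t0, u)))"
        by (rule continuous_on_compose2[OF contL])
           (use upper1 Hnz in \<open>auto intro!: continuous_intros continuous_on_compose2[OF contH]\<close>)
    qed (use Hnz expL g in auto)
    then show ?thesis by (simp add: H0 H1 a_def)
  qed
  \<comment> \<open>second half: chords from the other points to the lowest point, which point downwards\<close>
  have edge2: "g (t0, 1) - L a = g (t0 + 1, 0) - L (- a)"
  proof -
    have "g (t0 + 1 - 1, 1) + \<i> * of_real pi - L (- H (t0 + 1 - 1, 1)) = g (t0 + 1 - 0, 0) + \<i> * of_real pi - L (- H (t0 + 1 - 0, 0))"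
    proof (rule continuous_logarithms_differ_by_constant
        [of "{0..1::real}" "\<lambda>u. g (t0 + 1 - u, u) + \<i> * of_real pi" "\<lambda>u. L (- H (t0 + 1 - u, u))"])
      show "continuous_on {0..1} (\<lambda>u. g (t0 + 1 - u, u) + \<i> * of_real pi)"
        by (intro continuous_intros contg') auto
      show "continuous_on {0..1} (\<lambda>u. L (- H (t0 + 1 - u, u)))"
        by (rule continuous_on_compose2[OF contL])
           (use upper2 Hnz in \<open>auto intro!: continuous_intros continuous_on_compose2[OF contH]\<close>)
    qed (use Hnz expL g in \<open>auto simp: exp_add\<close>)
    then show ?thesis by (simp add: H0 H1 a_def perv)
  qed
  define l where "l = (\<lambda>t. g (t, 0))"
  have contl: "continuous_on A l" for A
    unfolding l_def by (rule contg') (auto intro!: continuous_intros)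
  have expl: "exp (l t) = v t" for t
    using g[of "(t, 0)"] by (simp add: l_def H0)
  \<comment> \<open>the starting point of the period does not matter, since the change of \<open>l\<close> over a period is continuous and lies in \<open>2\<pi>\<i>\<int>\<close>\<close>
  have "l (0 + 1) - l 0 = l (t0 + 1) - l t0"
    by (rule continuous_logarithms_differ_by_constant[of UNIV "\<lambda>t. l (t + 1)" l])
       (auto simp: expl perv intro!: contl continuous_on_compose2[OF contl[of UNIV]] continuous_intros)
  also have "\<dots> = 2 * (L (- a) - L a)"
    using edge1 edge2 unfolding l_def by algebra
  also have "\<dots> = 2 * of_real pi * \<i> * of_real (sgn (Re a))"
    by (simp add: jump)
  finally have "l 1 - l 0 = 2 * of_real pi * \<i> * of_real (sgn (Re a))" by simp
  moreover have "winding_number (exp \<circ> l) 0 = (pathfinish l - pathstart l) / (2 * of_real pi * \<i>)"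
    by (rule winding_number_compose_exp) (simp add: path_def contl)
  moreover have "exp \<circ> l = v" by (auto simp: expl)
  ultimately have "winding_number v 0 = of_real (sgn (Re a))"
    by (simp add: pathfinish_def pathstart_def)
  then show ?thesis using Rea by (simp add: sgn_if)
qed

section \<open>Solutions of the differential equation and periodic orbits\<close>

text \<open>Gronwall's inequality: the hypotheses make \<open>\<parallel>u\<parallel>\<^sup>2 e\<^sup>-\<^sup>2\<^sup>L\<^sup>t\<close> nonincreasing.\<close>

lemma norm_le_exp_of_linear_growth:
  fixes u v :: "real \<Rightarrow> 'a::real_inner"
  assumes "a \<le> b"
    and der: "\<And>t. t \<in> {a..b} \<Longrightarrow> (u has_vector_derivative v t) (at t)"
    and bd: "\<And>t. t \<in> {a..b} \<Longrightarrow> norm (v t) \<le> L * norm (u t)"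
  shows "norm (u b) \<le> norm (u a) * exp (L * (b - a))"
proof -
  define \<phi> where "\<phi> t = (u t \<bullet> u t) * exp (- 2 * L * t)" for t
  have "\<phi> b \<le> \<phi> a"
  proof (rule DERIV_nonpos_imp_nonincreasing[OF \<open>a \<le> b\<close>])
    fix t assume "a \<le> t" "t \<le> b"
    then have t: "t \<in> {a..b}" by simp
    have "((\<lambda>t. u t \<bullet> u t) has_real_derivative (u t \<bullet> v t + v t \<bullet> u t)) (at t)"
      using bounded_bilinear.has_vector_derivative[OF bounded_bilinear_inner der[OF t] der[OF t]]
      by (simp add: has_real_derivative_iff_has_vector_derivative)
    then have "(\<phi> has_real_derivative 2 * (u t \<bullet> v t - L * (u t \<bullet> u t)) * exp (- 2 * L * t)) (at t)"
      unfolding \<phi>_def by (auto intro!: derivative_eq_intros simp: inner_commute algebra_simps)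
    moreover have "u t \<bullet> v t \<le> L * (u t \<bullet> u t)"
    proof -
      have "u t \<bullet> v t \<le> norm (u t) * norm (v t)" by (rule norm_cauchy_schwarz)
      also have "\<dots> \<le> norm (u t) * (L * norm (u t))" by (intro mult_left_mono bd t) simp
      finally show ?thesis by (simp add: dot_square_norm power2_eq_square algebra_simps)
    qed
    ultimately show "\<exists>y. (\<phi> has_real_derivative y) (at t) \<and> y \<le> 0"
      by (intro exI[of _ "2 * (u t \<bullet> v t - L * (u t \<bullet> u t)) * exp (- 2 * L * t)"])
         (simp add: mult_le_0_iff)
  qed
  then have "\<phi> b * exp (2 * L * b) \<le> \<phi> a * exp (2 * L * b)"
    by (rule mult_right_mono) simp
  then have "u b \<bullet> u b \<le> (u a \<bullet> u a) * exp (2 * (L * (b - a)))"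
    unfolding \<phi>_def by (simp add: mult.assoc algebra_simps flip: exp_add)
  then have "(norm (u b))\<^sup>2 \<le> (norm (u a) * exp (L * (b - a)))\<^sup>2"
    by (simp add: dot_square_norm power_mult_distrib exp_double)
  then show ?thesis
    by (rule power2_le_imp_le) simp
qed

text \<open>Both solutions stay in a compact disc, on which \<open>F\<close> is Lipschitz, so Gronwall's inequality applies
  to their difference. Applied to a complex multiple of the vector field, the statement also gives
  uniqueness backwards in time and along a segment of complex times.\<close>

lemma holomorphic_ode_unique:
  fixes x y :: "real \<Rightarrow> complex"
  assumes holF: "F holomorphic_on UNIV"
    and x: "\<And>t. t \<in> {0..1} \<Longrightarrow> (x has_vector_derivative F (x t)) (at t)"
    and y: "\<And>t. t \<in> {0..1} \<Longrightarrow> (y has_vector_derivative F (y t)) (at t)"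
    and "x 0 = y 0"
  shows "x 1 = y 1"
proof -
  have cx: "continuous_on {0..1} x" and cy: "continuous_on {0..1} y"
    using x y by (meson continuous_at_imp_continuous_on has_vector_derivative_continuous)+
  have "compact (x ` {0..1} \<union> y ` {0..1})"
    using cx cy by (intro compact_Un compact_continuous_image) auto
  then obtain R where "\<And>z. z \<in> x ` {0..1} \<union> y ` {0..1} \<Longrightarrow> norm z \<le> R"
    using compact_imp_bounded bounded_iff by metis
  then have R: "x t \<in> cball 0 R" "y t \<in> cball 0 R" if "t \<in> {0..1}" for t
    using that by auto
  have dF: "(F has_field_derivative deriv F z) (at z)" for z
    using holF holomorphic_derivI by blast
  have "compact (deriv F ` cball 0 R)"
    using holF by (intro compact_continuous_image holomorphic_on_imp_continuous_on) 
      (auto intro: holomorphic_on_subset[OF holomorphic_deriv])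
  then obtain L where "\<And>z. z \<in> deriv F ` cball 0 R \<Longrightarrow> norm z \<le> L"
    using compact_imp_bounded bounded_iff by metis
  then have L: "norm (F z - F w) \<le> L * norm (z - w)" if "z \<in> cball 0 R" "w \<in> cball 0 R" for z w
    using field_differentiable_bound[of "cball 0 R" F "deriv F" L z w] that
    by (auto intro: has_field_derivative_at_within[OF dF])
  have "norm (x 1 - y 1) \<le> norm (x 0 - y 0) * exp (L * (1 - 0))"
    by (rule norm_le_exp_of_linear_growth[where v = "\<lambda>t. F (x t) - F (y t)"])
       (use x y L R in \<open>auto intro!: has_vector_derivative_diff\<close>)
  then show ?thesis using \<open>x 0 = y 0\<close> by simp
qed

lemma global_solution_affine:
  assumes "global_solution f \<gamma>"
  shows "((\<lambda>s. \<gamma> (a + s * b)) has_vector_derivative of_real b * f (\<gamma> (a + s * b))) (at s)"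
proof -
  have "((\<lambda>s. a + s * b) has_vector_derivative b) (at s)"
    by (auto intro!: derivative_eq_intros)
  from vector_diff_chain_at[OF this, of \<gamma> "f (\<gamma> (a + s * b))"] assms show ?thesis
    by (simp add: global_solution_def o_def scaleR_conv_of_real)
qed

lemma global_solution_shift:
  assumes "global_solution f \<gamma>"
  shows "global_solution f (\<lambda>t. \<gamma> (t + c))"
  using global_solution_affine[OF assms, of c 1] by (simp add: global_solution_def add.commute)

lemma global_solution_unique:
  assumes "f holomorphic_on UNIV" "global_solution f \<gamma>" "global_solution f \<delta>" "\<gamma> a = \<delta> a"
  shows "\<gamma> = \<delta>"
proof
  fix t
  have "\<gamma> (a + 1 * (t - a)) = \<delta> (a + 1 * (t - a))"
    by (rule holomorphic_ode_unique[where F = "\<lambda>z. of_real (t - a) * f z"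
          and x = "\<lambda>s. \<gamma> (a + s * (t - a))" and y = "\<lambda>s. \<delta> (a + s * (t - a))"])
       (use assms in \<open>auto intro!: holomorphic_intros global_solution_affine simp del: of_real_diff\<close>)
  then show "\<gamma> t = \<delta> t" by simp
qed

lemma periodic_orbit_nonzero:
  assumes "f holomorphic_on UNIV" "periodic_orbit f \<gamma>"
  shows "f (\<gamma> t) \<noteq> 0"
proof
  assume "f (\<gamma> t) = 0"
  then have "global_solution f (\<lambda>_. \<gamma> t)" by (simp add: global_solution_def)
  then have "\<gamma> = (\<lambda>_. \<gamma> t)"
    using assms by (intro global_solution_unique[where a = t]) (auto simp: periodic_orbit_def)
  then have "\<gamma> constant_on UNIV" unfolding constant_on_def by metis
  then show False using assms by (simp add: periodic_orbit_def)
qed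

text \<open>Since \<open>\<gamma>'(0) \<noteq> 0\<close>, the orbit does not return to \<open>\<gamma>(0)\<close> before some time \<open>d > 0\<close>. So the difference of
  two periods is never strictly between \<open>0\<close> and \<open>d\<close>, and the infimum of the periods is attained.\<close>

lemma
  assumes holf: "f holomorphic_on UNIV" and orb: "periodic_orbit f \<gamma>"
  shows minimal_period_is_period: "is_period \<gamma> (minimal_period \<gamma>)"
    and orbit_injective: "\<And>s u. 0 < u \<Longrightarrow> u < minimal_period \<gamma> \<Longrightarrow> \<gamma> (s + u) \<noteq> \<gamma> s"
proof -
  have sol: "global_solution f \<gamma>" using orb by (simp add: periodic_orbit_def)
  \<comment> \<open>\<open>\<gamma>\<close> moves strictly in the direction \<open>v\<close> for a short time\<close>
  define v where "v = f (\<gamma> 0)"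
  have "v \<noteq> 0" using periodic_orbit_nonzero[OF assms] by (simp add: v_def)
  have "(\<gamma> has_vector_derivative v) (at 0)"
    using sol by (simp add: global_solution_def v_def)
  then have "((\<lambda>t. v \<bullet> \<gamma> t) has_real_derivative v \<bullet> v) (at 0)"
    unfolding has_real_derivative_iff_has_vector_derivative
    by (rule bounded_linear.has_vector_derivative[OF bounded_linear_inner_right])
  then obtain d where d: "d > 0" "\<And>h. 0 < h \<Longrightarrow> h < d \<Longrightarrow> v \<bullet> \<gamma> 0 < v \<bullet> \<gamma> (0 + h)"
    using DERIV_pos_inc_right[of "\<lambda>t. v \<bullet> \<gamma> t" "v \<bullet> v" 0] \<open>v \<noteq> 0\<close> by auto
  have no_small: "\<not> is_period \<gamma> h" if "h < d" for h
    using d(2)[of h] that unfolding is_period_def by (metis less_irrefl)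
  define m where "m = Inf {T. is_period \<gamma> T}"
  have bdd: "bdd_below {T. is_period \<gamma> T}"
    by (rule bdd_belowI[of _ 0]) (simp add: is_period_def)
  obtain T where T: "is_period \<gamma> T" "T < m + d"
    using cInf_lessD[of "{T. is_period \<gamma> T}" "m + d"] orb \<open>d > 0\<close>
    by (auto simp: m_def periodic_orbit_def)
  have least: "T \<le> T'" if T': "is_period \<gamma> T'" for T'
  proof (rule ccontr)
    assume "\<not> T \<le> T'"
    moreover have "\<gamma> (t + (T - T')) = \<gamma> t" for t
      using T(1) T' unfolding is_period_def by (metis add.commute add_diff_eq diff_add_cancel)
    ultimately have "is_period \<gamma> (T - T')" by (simp add: is_period_def)
    moreover have "m \<le> T'" unfolding m_def by (rule cInf_lower[OF _ bdd]) (use T' in simp)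
    ultimately show False using no_small[of "T - T'"] T by simp
  qed
  have eq: "minimal_period \<gamma> = T"
    unfolding minimal_period_def using T least by (intro Least_equality)
  show "is_period \<gamma> (minimal_period \<gamma>)" using T eq by simp
  show "\<gamma> (s + u) \<noteq> \<gamma> s" if "0 < u" "u < minimal_period \<gamma>" for s u
  proof
    assume "\<gamma> (s + u) = \<gamma> s"
    then have "(\<lambda>t. \<gamma> (t + u)) = \<gamma>"
      using global_solution_unique[OF holf global_solution_shift[OF sol] sol] by blast
    then have "is_period \<gamma> u" using that by (simp add: is_period_def) metis
    then show False using least that eq by force
  qed
qed

text \<open>The path whose winding number is the index of the orbit.\<close>

definition orbit_loop :: "(real \<Rightarrow> complex) \<Rightarrow> real \<Rightarrow> complex" where
  "orbit_loop \<gamma> = (\<lambda>s. \<gamma> (s * minimal_period \<gamma>))"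

context
  fixes f \<gamma>
  assumes holf: "f holomorphic_on UNIV" and orb: "periodic_orbit f \<gamma>"
begin

private abbreviation (input) "p \<equiv> orbit_loop \<gamma>"
private abbreviation (input) "T \<equiv> minimal_period \<gamma>"

lemma minimal_period_pos: "T > 0"
  using minimal_period_is_period[OF holf orb] by (simp add: is_period_def)

lemma orbit_loop_vector_derivative:
  "(p has_vector_derivative of_real T * f (p s)) (at s)"
  using global_solution_affine[of f \<gamma> 0 T] orb by (simp add: orbit_loop_def periodic_orbit_def)

lemma orbit_loop_periodic: "p (s + 1) = p s"
  using minimal_period_is_period[OF holf orb] by (simp add: orbit_loop_def is_period_def distrib_right)

lemma orbit_loop_injective: "0 < u \<Longrightarrow> u < 1 \<Longrightarrow> p (s + u) \<noteq> p s"
  using orbit_injective[OF holf orb, of "u * T" "s * T"] minimal_period_pos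
  by (simp add: orbit_loop_def distrib_right)

lemma continuous_on_orbit_loop: "continuous_on A p"
  using orbit_loop_vector_derivative
  by (meson continuous_at_imp_continuous_on has_vector_derivative_continuous)

lemma continuous_on_field_orbit_loop: "continuous_on A (\<lambda>s. f (p s))"
  by (rule continuous_on_compose2[OF holomorphic_on_imp_continuous_on[OF holf] continuous_on_orbit_loop]) simp

lemma valid_path_orbit_loop: "valid_path p"
  unfolding valid_path_def
  by (rule C1_differentiable_imp_piecewise)
     (auto simp: C1_differentiable_on_def intro!: orbit_loop_vector_derivative
        continuous_on_field_orbit_loop continuous_intros exI[of _ "\<lambda>s. of_real T * f (p s)"])

lemma closed_orbit_loop: "pathfinish p = pathstart p"
  using orbit_loop_periodic[of 0] by (simp add: pathfinish_def pathstart_def)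

lemma simple_path_orbit_loop: "simple_path p"
proof -
  have *: "x = 0 \<and> y = 1" if "x \<in> {0..1}" "y \<in> {0..1}" "p x = p y" "x < y" for x y
    using orbit_loop_injective[of "y - x" x] that by (cases "y - x < 1") auto
  have "loop_free p"
    unfolding loop_free_def
  proof (intro ballI impI)
    fix x y :: real assume "x \<in> {0..1}" "y \<in> {0..1}" "p x = p y"
    then show "x = y \<or> x = 0 \<and> y = 1 \<or> x = 1 \<and> y = 0"
      using *[of x y] *[of y x] by (cases x y rule: linorder_cases) auto
  qed
  then show ?thesis
    using valid_path_imp_path[OF valid_path_orbit_loop] by (simp add: simple_path_def)
qed

lemma path_image_orbit_loop: "path_image p = range \<gamma>"
proof -
  have "\<gamma> t \<in> p ` {0..1}" for t
  proof
    show "\<gamma> t = p (frac (t / T))"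
      using is_period_frac[OF minimal_period_is_period[OF holf orb]]
      by (simp add: orbit_loop_def)
    show "frac (t / T) \<in> {0..1}"
      using frac_ge_0 frac_lt_1 less_imp_le by auto
  qed
  then show ?thesis by (auto simp: path_image_def orbit_loop_def)
qed

lemma orbit_tangent_winding: "norm (winding_number (\<lambda>s. of_real T * f (p s)) 0) = 1"
proof (rule umlaufsatz[where p = p and v = "\<lambda>s. of_real T * f (p s)",
      OF orbit_loop_vector_derivative _ _ orbit_loop_periodic orbit_loop_injective])
  show "continuous_on UNIV (\<lambda>s. of_real T * f (p s))"
    by (intro continuous_intros continuous_on_field_orbit_loop)
  show "of_real T * f (p t) \<noteq> 0" for t
    using periodic_orbit_nonzero[OF holf orb] minimal_period_pos by (simp add: orbit_loop_def)
qed

end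

section \<open>Counting zeros inside a Jordan curve\<close>

text \<open>Substitution in the integral of \<open>1/w\<close> over \<open>\<phi> \<circ> p\<close>.\<close>

lemma winding_number_holomorphic_image:
  assumes "open S" "\<phi> holomorphic_on S" "valid_path p" "path_image p \<subseteq> S"
    and nz: "\<And>z. z \<in> path_image p \<Longrightarrow> \<phi> z \<noteq> 0"
  shows "contour_integral p (\<lambda>z. deriv \<phi> z / \<phi> z) = 2 * of_real pi * \<i> * winding_number (\<phi> \<circ> p) 0"
proof -
  have an: "\<phi> analytic_on S" using assms analytic_on_open by blast
  have "valid_path (\<phi> \<circ> p)"
    using assms an by (intro valid_path_compose_analytic[where S = S]) auto
  moreover have "0 \<notin> path_image (\<phi> \<circ> p)" using nz by (force simp: path_image_compose)
  ultimately have "2 * of_real pi * \<i> * winding_number (\<phi> \<circ> p) 0 = contour_integral (\<phi> \<circ> p) (\<lambda>w. 1 / w)"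
    by (simp add: winding_number_valid_path)
  also have "\<dots> = contour_integral p (\<lambda>w. deriv \<phi> w * (1 / \<phi> w))"
    using contour_integral_comp_analyticW[OF an \<open>valid_path p\<close> assms(4), of "\<lambda>w. 1 / w"] by simp
  finally show ?thesis by simp
qed

lemma compact_closed_inside_of_simple_loop:
  fixes p :: "real \<Rightarrow> complex"
  assumes "simple_path p" "pathfinish p = pathstart p"
  defines "K \<equiv> inside (path_image p) \<union> path_image p"
  shows "compact K" "connected K" "K = closure (inside (path_image p))" "- K = outside (path_image p)"
proof -
  note J = Jordan_inside_outside[OF assms(1,2)]
  show K: "K = closure (inside (path_image p))"
    using J unfolding K_def closure_Un_frontier by simp
  show "compact K" "connected K"
    unfolding K using J by (simp_all add: connected_imp_connected_closure)
  show "- K = outside (path_image p)" using J unfolding K_def by blast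
qed

text \<open>By the argument principle, the winding number of \<open>\<phi> \<circ> p\<close> is, up to sign, the number of zeros
  inside \<open>p\<close> counted with multiplicity. Zeros of \<open>\<phi>\<close> in \<open>S\<close> may accumulate at the boundary of \<open>S\<close>,
  so the principle is applied on a bounded connected neighbourhood of the closed inside whose closure
  lies in \<open>S\<close>.\<close>

theorem unique_simple_zero_inside:
  assumes p: "simple_path p" "pathfinish p = pathstart p" "valid_path p"
    and S: "open S" "inside (path_image p) \<union> path_image p \<subseteq> S" and hol: "\<phi> holomorphic_on S"
    and nz: "\<And>z. z \<in> path_image p \<Longrightarrow> \<phi> z \<noteq> 0"
    and wn: "norm (winding_number (\<phi> \<circ> p) 0) = 1"
  obtains z where "{z \<in> inside (path_image p). \<phi> z = 0} = {z}" "deriv \<phi> z \<noteq> 0"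
proof -
  define I where "I = inside (path_image p)"
  define K where "K = I \<union> path_image p"
  have K: "compact K" "connected K" "- K = outside (path_image p)"
    using compact_closed_inside_of_simple_loop[OF p(1,2)] by (simp_all add: K_def I_def)
  have "K \<noteq> {}" by (simp add: K_def)
  obtain e where e: "e > 0" "(\<Union>x\<in>K. ball x e) \<subseteq> S"
    using compact_subset_open_imp_ball_epsilon_subset[OF K(1) S(1)] S(2) by (auto simp: K_def I_def)
  have nbhd: "open (\<Union>x\<in>K. ball x r)" "connected (\<Union>x\<in>K. ball x r)" "K \<subseteq> (\<Union>x\<in>K. ball x r)"
    if "r > 0" for r
  proof -
    show sub: "K \<subseteq> (\<Union>x\<in>K. ball x r)" using that by force
    have "connected (\<Union>x\<in>K. K \<union> ball x r)"
    proof (rule connected_Union)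
      show "connected s" if "s \<in> (\<lambda>x. K \<union> ball x r) ` K" for s
        using that K(2) \<open>r > 0\<close> by (auto intro!: connected_Un)
      show "\<Inter> ((\<lambda>x. K \<union> ball x r) ` K) \<noteq> {}" using \<open>K \<noteq> {}\<close> by blast
    qed
    moreover have "(\<Union>x\<in>K. K \<union> ball x r) = (\<Union>x\<in>K. ball x r)" using sub by blast
    ultimately show "connected (\<Union>x\<in>K. ball x r)" by simp
  qed auto
  define B where "B = (\<Union>x\<in>K. ball x e)"
  define A where "A = (\<Union>x\<in>K. ball x (e / 2))"
  note B = nbhd[OF e(1), folded B_def]
  have A: "open A" "connected A" "K \<subseteq> A" using nbhd[of "e / 2"] e(1) by (simp_all add: A_def)
  have holB: "\<phi> holomorphic_on B" using hol e(2) holomorphic_on_subset by (auto simp: B_def)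
  define L where "L = {x + y |x y. x \<in> K \<and> y \<in> cball 0 (e / 2)}"
  have "compact L" unfolding L_def using K(1) by (intro compact_sums) auto
  have "A \<subseteq> L"
  proof
    fix z assume "z \<in> A"
    then obtain x where "x \<in> K" "dist x z < e / 2" by (auto simp: A_def)
    then show "z \<in> L"
      unfolding L_def by (intro CollectI exI[of _ x] exI[of _ "z - x"]) (auto simp: dist_norm norm_minus_commute)
  qed
  have "L \<subseteq> B"
  proof
    fix z assume "z \<in> L"
    then obtain x y where "z = x + y" "x \<in> K" "norm y \<le> e / 2" by (auto simp: L_def)
    then show "z \<in> B" using e(1) by (auto simp: B_def dist_norm intro!: bexI[of _ x])
  qed
  have pA: "path_image p \<subseteq> A" "I \<subseteq> A" using A(3) by (auto simp: K_def)
  have "\<not> \<phi> constant_on B"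
  proof
    assume "\<phi> constant_on B"
    then obtain a where a: "\<And>z. z \<in> B \<Longrightarrow> \<phi> z = a" by (auto simp: constant_on_def)
    have "(\<phi> \<circ> p) t = linepath a a t" if "0 \<le> t" "t \<le> 1" for t
      using that a[of "p t"] pA(1) \<open>A \<subseteq> L\<close> \<open>L \<subseteq> B\<close> by (force simp: path_image_def linepath_def algebra_simps)
    moreover have "a \<noteq> 0"
      using nz[of "pathstart p"] a[of "pathstart p"] pA(1) \<open>A \<subseteq> L\<close> \<open>L \<subseteq> B\<close> by auto
    ultimately have "winding_number (\<phi> \<circ> p) 0 = 0"
      using winding_number_cong[of "\<phi> \<circ> p" "linepath a a" 0] winding_number_trivial[of a 0] by simp
    then show False using wn by simp
  qed
  then have "finite {z \<in> L. \<phi> z = 0}"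
    using holomorphic_compact_finite_zeros[OF holB B(1,2) \<open>compact L\<close> \<open>L \<subseteq> B\<close>] by blast
  then have finA: "finite {z \<in> A. \<phi> z = 0 \<or> z \<in> {}}"
    by (rule rev_finite_subset) (use \<open>A \<subseteq> L\<close> in auto)
  define Z where "Z = {z \<in> I. \<phi> z = 0}"
  have "Z \<subseteq> {z \<in> A. \<phi> z = 0 \<or> z \<in> {}}" using pA by (auto simp: Z_def)
  then have finZ: "finite Z" using finA finite_subset by blast
  have holA: "\<phi> holomorphic_on A"
    using holB \<open>A \<subseteq> L\<close> \<open>L \<subseteq> B\<close> by (meson holomorphic_on_subset subset_trans)
  have out: "winding_number p z = 0" if "z \<notin> K" for z
    using that K(3) winding_number_zero_in_outside[OF simple_path_imp_path[OF p(1)] p(2), of z] by blast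
  obtain w where w: "norm w = 1" "\<And>z. z \<in> I \<Longrightarrow> winding_number p z = w"
    using simple_closed_path_winding_number_inside[OF p(1)] unfolding I_def
    by (metis norm_minus_cancel norm_one)
  have "2 * of_real pi * \<i> * winding_number (\<phi> \<circ> p) 0 = contour_integral p (\<lambda>z. deriv \<phi> z * 1 / \<phi> z)"
    using winding_number_holomorphic_image[OF A(1) holA p(3) pA(1) nz] by simp
  also have "\<dots> = 2 * of_real pi * \<i> * (\<Sum>q\<in>{z \<in> A. \<phi> z = 0 \<or> z \<in> {}}. winding_number p q * 1 * zorder \<phi> q)"
  proof -
    have "path_image p \<subseteq> A - {z \<in> A. \<phi> z = 0 \<or> z \<in> {}}" using nz pA by auto
    moreover have "\<forall>z. z \<notin> A \<longrightarrow> winding_number p z = 0" using out A(3) by blast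
    ultimately show ?thesis
      using argument_principle[of A \<phi> "{}" "\<lambda>_. 1" p] A holA p finA by simp
  qed
  also have "(\<Sum>q\<in>{z \<in> A. \<phi> z = 0 \<or> z \<in> {}}. winding_number p q * 1 * zorder \<phi> q) =
      (\<Sum>q\<in>Z. winding_number p q * 1 * zorder \<phi> q)"
    using finA out nz pA by (intro sum.mono_neutral_right) (auto simp: Z_def K_def)
  also have "\<dots> = w * of_int (\<Sum>q\<in>Z. zorder \<phi> q)"
    by (simp add: sum_distrib_left) (use w in \<open>auto simp: Z_def intro!: sum.cong\<close>)
  finally have "winding_number (\<phi> \<circ> p) 0 = w * of_int (\<Sum>q\<in>Z. zorder \<phi> q)"
    by (simp add: o_def)
  then have abs1: "\<bar>\<Sum>q\<in>Z. zorder \<phi> q\<bar> = 1"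
    using wn w(1) by (simp add: norm_mult flip: of_int_sum of_int_abs)
  have "\<exists>w\<in>A. \<phi> w \<noteq> 0"
    using nz[of "pathstart p"] pA(1) by (intro bexI[of _ "pathstart p"]) auto
  note zo = zorder_exist_zero[OF holA A(1,2) _ this]
  have pos: "1 \<le> zorder \<phi> q" if "q \<in> Z" for q
    using zo[of q] that pA by (auto simp: Z_def)
  have "int (card Z) \<le> (\<Sum>q\<in>Z. zorder \<phi> q)"
    using sum_mono[of Z "\<lambda>_. 1::int" "zorder \<phi>"] pos by simp
  moreover have "Z \<noteq> {}" using abs1 by auto
  ultimately have "card Z = 1"
    using abs1 finZ by (smt (verit) card_gt_0_iff of_nat_0_less_iff of_nat_eq_1_iff)
  then obtain z where z: "Z = {z}" by (metis card_1_singletonE)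
  with abs1 pos have zo1: "zorder \<phi> z = 1" by force
  have "z \<in> A" using z pA by (auto simp: Z_def)
  from zo[OF this] obtain r where r: "r > 0" "zor_poly \<phi> z holomorphic_on cball z r"
      "\<And>w. w \<in> cball z r \<Longrightarrow> \<phi> w = zor_poly \<phi> z w * (w - z) \<and> zor_poly \<phi> z w \<noteq> 0"
    unfolding zo1 by auto
  have "(zor_poly \<phi> z has_field_derivative deriv (zor_poly \<phi> z) z) (at z)"
    using r by (intro holomorphic_derivI[of _ "ball z r"]) (auto intro: holomorphic_on_subset)
  then have "((\<lambda>w. zor_poly \<phi> z w * (w - z)) has_field_derivative zor_poly \<phi> z z) (at z)"
    by (auto intro!: derivative_eq_intros)
  then have "(\<phi> has_field_derivative zor_poly \<phi> z z) (at z)"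
    by (rule has_field_derivative_transform_within_open[of _ _ _ "ball z r"]) (use r in auto)
  then have "deriv \<phi> z \<noteq> 0" using DERIV_imp_deriv r by fastforce
  with z that show ?thesis by (auto simp: Z_def I_def)
qed

section \<open>Simply connected neighbourhoods, linearization and local injectivity\<close>

text \<open>Remove from the disc an arc from each point of \<open>Z\<close> to a point outside the disc, chosen in the connected
  complement of \<open>K\<close>. Arcs and exterior of the disc form a connected set, so each component of its
  complement again has a connected complement, which for bounded open connected sets in the plane means
  simple connectedness.\<close>

lemma simply_connected_neighbourhood_avoiding_finite:
  fixes K Z :: "complex set"
  assumes K: "compact K" "connected K" "K \<noteq> {}" "connected (- K)" and "K \<subseteq> ball 0 R"
    and Z: "finite Z" "Z \<inter> K = {}"
  obtains W where "open W" "simply_connected W" "K \<subseteq> W" "W \<subseteq> ball 0 R" "W \<inter> Z = {}"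
proof -
  obtain b :: complex where b: "b \<notin> ball 0 R"
    by (metis bounded_ball not_bounded_UNIV UNIV_eq_I)
  have "path_connected (- K)"
    using K compact_imp_closed connected_open_path_connected by blast
  then have "\<exists>g. path g \<and> path_image g \<subseteq> - K \<and> pathstart g = z \<and> pathfinish g = b" if "z \<in> Z" for z
  proof -
    have "z \<in> - K" "b \<in> - K" using that Z b \<open>K \<subseteq> ball 0 R\<close> by auto
    with \<open>path_connected (- K)\<close> show ?thesis unfolding path_connected_def by blast
  qed
  then obtain g where g: "\<And>z. z \<in> Z \<Longrightarrow> path (g z) \<and> path_image (g z) \<subseteq> - K \<and> pathstart (g z) = z \<and> pathfinish (g z) = b"
    by metis
  define A where "A = - ball 0 R \<union> (\<Union>z\<in>Z. path_image (g z))"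
  have "connected (\<Union>(insert (- ball 0 R) ((\<lambda>z. path_image (g z)) ` Z)))"
  proof (rule connected_Union)
    have "connected (- ball (0::complex) R)"
      by (rule connected_complement_bounded_convex) (auto)
    then show "connected s" if "s \<in> insert (- ball 0 R) ((\<lambda>z. path_image (g z)) ` Z)" for s
      using that g connected_path_image by auto
    have "b \<in> s" if "s \<in> insert (- ball 0 R) ((\<lambda>z. path_image (g z)) ` Z)" for s
      using that g b pathfinish_in_path_image by (metis ComplI imageE insertE)
    then show "\<Inter> (insert (- ball 0 R) ((\<lambda>z. path_image (g z)) ` Z)) \<noteq> {}" by blast
  qed
  then have "connected A" by (simp add: A_def)
  have "closed A"
    unfolding A_def using Z(1) g by (intro closed_Un closed_UN) (auto simp: closed_path_image)
  have "K \<subseteq> - A" using g \<open>K \<subseteq> ball 0 R\<close> by (auto simp: A_def)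
  obtain x where "x \<in> K" using K by blast
  define W where "W = connected_component_set (- A) x"
  have W: "W \<in> components (- A)"
    unfolding W_def using \<open>x \<in> K\<close> \<open>K \<subseteq> - A\<close> componentsI by blast
  have "W \<subseteq> - A" unfolding W_def by (rule connected_component_subset)
  moreover have "z \<in> A" if "z \<in> Z" for z
    using g[OF that] pathstart_in_path_image[of "g z"] that by (auto simp: A_def)
  ultimately have "W \<inter> Z = {}" by blast
  have "W \<subseteq> ball 0 R" using \<open>W \<subseteq> - A\<close> by (auto simp: A_def)
  have "open W"
    unfolding W_def using \<open>closed A\<close> by (intro open_connected_component) auto
  moreover have "connected (- W)" by (rule component_complement_connected[OF \<open>connected A\<close> W])
  moreover have "connected W" using W in_components_connected by blast
  moreover have "bounded W" using \<open>W \<subseteq> ball 0 R\<close> bounded_ball bounded_subset by blast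
  moreover have "K \<subseteq> W"
    unfolding W_def using K \<open>K \<subseteq> - A\<close> \<open>x \<in> K\<close> by (intro connected_component_maximal)
  ultimately show ?thesis
    using that[of W] simply_connected_iff_simple[of W] \<open>open W\<close> \<open>W \<inter> Z = {}\<close> \<open>W \<subseteq> ball 0 R\<close> by simp
qed

text \<open>The function \<open>h = exp (\<integral> \<lambda>/f)\<close> with \<open>\<lambda> = deriv f c\<close>. Since \<open>\<lambda>/f\<close> has a simple pole at \<open>c\<close> with
  residue \<open>1\<close>, it is \<open>1/(z - c)\<close> plus a holomorphic function, whose primitive is \<open>G\<close>; so \<open>h\<close> is
  \<open>(z - c) exp (G z)\<close>.\<close>

lemma linearizing_function:
  assumes W: "open W" "simply_connected W" and hol: "f holomorphic_on W"
    and c: "c \<in> W" "f c = 0" "deriv f c \<noteq> 0" and nz: "\<And>z. z \<in> W \<Longrightarrow> z \<noteq> c \<Longrightarrow> f z \<noteq> 0"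
  obtains G h where "G holomorphic_on W" "h holomorphic_on W" "\<And>z. h z = (z - c) * exp (G z)"
    "\<And>z. z \<in> W \<Longrightarrow> deriv h z * f z = deriv f c * h z" "\<And>z. z \<in> W \<Longrightarrow> deriv h z \<noteq> 0"
    "\<And>z. z \<in> W \<Longrightarrow> z \<noteq> c \<Longrightarrow> deriv f c / f z = 1 / (z - c) + deriv G z"
proof -
  define l where "l = deriv f c"
  define q where "q = (\<lambda>z. if z = c then l else f z / (z - c))"
  have ci: "c \<in> interior W" using W c by (simp add: interior_open)
  have holq: "q holomorphic_on W"
    using pole_lemma[OF hol ci] by (simp add: q_def l_def c(2) cong: if_cong)
  have qnz: "q z \<noteq> 0" if "z \<in> W" for z using that c nz by (auto simp: q_def l_def)
  have f: "f z = (z - c) * q z" for z using c by (auto simp: q_def)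
  \<comment> \<open>\<open>m z = (z - c) \<lambda> / f z\<close>, and \<open>n\<close> below is the regular part \<open>\<lambda>/f - 1/(z - c)\<close>\<close>
  define m where "m = (\<lambda>z. l / q z)"
  have holm: "m holomorphic_on W" unfolding m_def using holq qnz by (intro holomorphic_intros)
  have mc: "m c = 1" using c by (simp add: m_def q_def l_def)
  define n where "n = (\<lambda>z. if z = c then deriv m c else (m z - m c) / (z - c))"
  have "n holomorphic_on W" unfolding n_def by (rule pole_lemma[OF holm ci])
  then obtain G where G: "\<And>z. z \<in> W \<Longrightarrow> (G has_field_derivative n z) (at z)"
    using W simply_connected_eq_global_primitive by metis
  have holG: "G holomorphic_on W"
    using G W(1) by (auto simp: holomorphic_on_open)
  define h where "h = (\<lambda>z. (z - c) * exp (G z))"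
  have mn: "m z = 1 + (z - c) * n z" for z by (simp add: n_def mc)
  have dh: "(h has_field_derivative m z * exp (G z)) (at z)" if "z \<in> W" for z
    unfolding h_def by (rule derivative_eq_intros G that refl)+ (simp add: mn algebra_simps)
  have "deriv f c / f z = 1 / (z - c) + deriv G z" if z: "z \<in> W" "z \<noteq> c" for z
  proof -
    have "l / f z = m z / (z - c)" using z qnz[OF z(1)] by (simp add: m_def f)
    also have "\<dots> = 1 / (z - c) + n z" using z by (simp add: mn add_divide_distrib)
    finally show ?thesis using G[OF z(1)] by (simp add: DERIV_imp_deriv l_def)
  qed
  moreover have "deriv h z * f z = deriv f c * h z" "deriv h z \<noteq> 0" if "z \<in> W" for z
    using DERIV_imp_deriv[OF dh[OF that]] qnz[OF that] c f[of z]
    by (auto simp: m_def h_def l_def)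
  moreover have "h holomorphic_on W"
    using dh W(1) by (auto simp: holomorphic_on_open)
  ultimately show ?thesis using that[of G h] holG by (simp add: h_def)
qed

text \<open>Every pair of points of \<open>K\<close> has a neighbourhood that contains no two different points with equal
  images: off the diagonal by continuity, on it because \<open>deriv h\<close> does not vanish. By compactness of
  \<open>K \<times> K\<close> these neighbourhoods can be taken of uniform size.\<close>

lemma injective_near_compact:
  assumes hol: "h holomorphic_on W" and W: "open W" and K: "compact K" "K \<subseteq> W" "inj_on h K"
    and reg: "\<And>z. z \<in> K \<Longrightarrow> deriv h z \<noteq> 0"
  obtains V where "open V" "K \<subseteq> V" "V \<subseteq> W" "inj_on h V"
proof -
  define Q where "Q = {z \<in> W \<times> W. h (fst z) = h (snd z) \<longrightarrow> fst z = snd z}"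
  have "K \<times> K \<subseteq> interior Q"
  proof
    fix z assume "z \<in> K \<times> K"
    then obtain a b where z: "z = (a, b)" "a \<in> K" "b \<in> K" by blast
    show "z \<in> interior Q"
    proof (cases "a = b")
      case True
      obtain r where r: "r > 0" "ball a r \<subseteq> W" "inj_on h (ball a r)"
        using has_complex_derivative_locally_injective[OF hol _ W reg[OF z(2)]] z K by blast
      have "ball a r \<times> ball a r \<subseteq> Q" using r by (force simp: Q_def inj_on_def)
      then show ?thesis
        using r(1) z True by (intro interiorI[of "ball a r \<times> ball a r"]) (auto intro: open_Times)
    next
      case False
      then have "h a \<noteq> h b" using K z by (auto simp: inj_on_def)
      let ?E = "{z \<in> W \<times> W. h (fst z) - h (snd z) \<in> - {0}}"
      have "continuous_on (W \<times> W) (\<lambda>z. h (fst z) - h (snd z))"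
        by (intro continuous_intros continuous_on_compose2[OF holomorphic_on_imp_continuous_on[OF hol]]) auto
      then have "open ((\<lambda>z. h (fst z) - h (snd z)) -` (- {0}) \<inter> (W \<times> W))"
        using W continuous_on_open_vimage[of "W \<times> W"] open_Times by blast
      then show ?thesis
        by (rule interiorI) (use z K \<open>h a \<noteq> h b\<close> in \<open>auto simp: Q_def\<close>)
    qed
  qed
  then obtain e where e: "e > 0" "(\<Union>x\<in>K \<times> K. ball x e) \<subseteq> interior Q"
    using compact_subset_open_imp_ball_epsilon_subset[of "K \<times> K" "interior Q"] K
    by (auto simp: compact_Times)
  define V where "V = (\<Union>x\<in>K. ball x (e / 2))"
  have Q: "(x, y) \<in> Q" if xy: "x \<in> V" "y \<in> V" for x y
  proof -
    obtain a b where "a \<in> K" "b \<in> K" "x \<in> ball a (e / 2)" "y \<in> ball b (e / 2)"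
      using xy unfolding V_def by blast
    then have ab: "a \<in> K" "b \<in> K" "dist a x < e / 2" "dist b y < e / 2" by simp_all
    have "dist (a, b) (x, y) \<le> dist a x + dist b y"
      unfolding dist_Pair_Pair by (rule sqrt_sum_squares_le_sum) auto
    then have "(x, y) \<in> ball (a, b) e" using ab by simp
    then show ?thesis using e(2) ab interior_subset by blast
  qed
  show ?thesis
  proof
    show "open V" by (auto simp: V_def)
    show "K \<subseteq> V" using e(1) by (force simp: V_def)
    show "V \<subseteq> W" using Q by (auto simp: Q_def)
    show "inj_on h V" using Q by (auto simp: Q_def inj_on_def)
  qed
qed

section \<open>The disc bounded by a periodic orbit\<close>

context
  fixes f \<gamma> c
  assumes holf: "f holomorphic_on UNIV" and around: "periodic_orbit_around f \<gamma> c" and c0: "f c = 0"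
begin

private abbreviation (input) "loop \<equiv> orbit_loop \<gamma>"
private abbreviation (input) "period \<equiv> minimal_period \<gamma>"

private lemma orb: "periodic_orbit f \<gamma>" and c_inside: "c \<in> inside (range \<gamma>)"
  using around by (simp_all add: periodic_orbit_around_def)

private lemmas p = simple_path_orbit_loop[OF holf orb] closed_orbit_loop[OF holf orb]
  valid_path_orbit_loop[OF holf orb]
private lemmas image = path_image_orbit_loop[OF holf orb]
private lemmas Tpos = minimal_period_pos[OF holf orb]

text \<open>The Umlaufsatz says that \<open>f\<close> has winding number \<open>\<plusminus>1\<close> along the orbit, because \<open>f\<close> is the tangent
  there.\<close>

lemma
  shows only_zero_inside_orbit: "\<And>z. z \<in> inside (range \<gamma>) \<Longrightarrow> f z = 0 \<Longrightarrow> z = c"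
    and deriv_nonzero_at_enclosed_zero: "deriv f c \<noteq> 0"
proof -
  let ?\<phi> = "\<lambda>z. of_real period * f z"
  have comp: "?\<phi> \<circ> loop = (\<lambda>s. of_real period * f (loop s))" by (simp add: o_def)
  obtain z where z: "{z \<in> inside (path_image loop). ?\<phi> z = 0} = {z}" "deriv ?\<phi> z \<noteq> 0"
  proof (rule unique_simple_zero_inside[OF p, of UNIV ?\<phi>])
    show "?\<phi> holomorphic_on UNIV" using holf by (intro holomorphic_intros)
    show "?\<phi> z \<noteq> 0" if "z \<in> path_image loop" for z
      using that Tpos periodic_orbit_nonzero[OF holf orb] image by auto
    show "norm (winding_number (?\<phi> \<circ> loop) 0) = 1"
      unfolding comp by (rule orbit_tangent_winding[OF holf orb])
  qed auto
  have "c \<in> {z \<in> inside (path_image loop). ?\<phi> z = 0}" using c_inside c0 image by simp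
  then have "z = c" unfolding z(1) by simp
  then show "w = c" if "w \<in> inside (range \<gamma>)" "f w = 0" for w
    using that z(1) image Tpos by auto
  have "f field_differentiable at c" using holf by (simp add: holomorphic_on_def)
  then have "deriv ?\<phi> c = of_real period * deriv f c" by (rule deriv_cmult)
  then show "deriv f c \<noteq> 0" using z(2) \<open>z = c\<close> by auto
qed

lemma neighbourhood_with_single_zero:
  obtains W where "open W" "simply_connected W" "inside (range \<gamma>) \<union> range \<gamma> \<subseteq> W"
    "\<And>z. z \<in> W \<Longrightarrow> z \<noteq> c \<Longrightarrow> f z \<noteq> 0"
proof -
  define K where "K = inside (range \<gamma>) \<union> range \<gamma>"
  have K: "compact K" "connected K" "connected (- K)" "K \<noteq> {}"
    using compact_closed_inside_of_simple_loop[OF p(1,2)] Jordan_inside_outside[OF p(1,2)]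
    by (auto simp: K_def image)
  obtain R where R: "K \<subseteq> ball 0 R"
    using compact_imp_bounded[OF K(1)] bounded_subset_ballD by blast
  have "\<not> f constant_on UNIV"
    using periodic_orbit_nonzero[OF holf orb] c0 unfolding constant_on_def by (metis UNIV_I)
  then have "finite {z \<in> cball 0 R. f z = 0}"
    by (intro holomorphic_compact_finite_zeros[OF holf]) auto
  then have fin: "finite ({z \<in> cball 0 R. f z = 0} - K)" by simp
  have disj: "({z \<in> cball 0 R. f z = 0} - K) \<inter> K = {}" by blast
  obtain W where W: "open W" "simply_connected W" "K \<subseteq> W" "W \<subseteq> ball 0 R"
      "W \<inter> ({z \<in> cball 0 R. f z = 0} - K) = {}"
    by (rule simply_connected_neighbourhood_avoiding_finite[OF K(1,2,4,3) R fin disj])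
  have "f z \<noteq> 0" if "z \<in> W" "z \<noteq> c" for z
  proof
    assume "f z = 0"
    then have "z \<in> K" using that W(4,5) by fastforce
    then have "z \<in> inside (range \<gamma>)"
      using \<open>f z = 0\<close> periodic_orbit_nonzero[OF holf orb] by (auto simp: K_def)
    then show False using only_zero_inside_orbit \<open>f z = 0\<close> that by blast
  qed
  with W that[of W] show ?thesis by (simp add: K_def)
qed

text \<open>The integral of \<open>deriv f c / f\<close> over the orbit in two ways: the integrand along the orbit is constant
  because \<open>dz = f dt\<close>, and the residue at \<open>c\<close> is \<open>1\<close>.\<close>

lemma
  shows deriv_times_period: "deriv f c * of_real period = 2 * of_real pi * \<i> * orbit_index \<gamma> c"
    and orbit_index_cases: "orbit_index \<gamma> c = 1 \<or> orbit_index \<gamma> c = -1"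
proof -
  have idx: "orbit_index \<gamma> c = winding_number loop c"
    by (simp add: orbit_index_def orbit_loop_def)
  have cp: "c \<in> inside (path_image loop)" "c \<notin> path_image loop"
    using c_inside image inside_no_overlap[of "range \<gamma>"] by (simp, blast)
  show "orbit_index \<gamma> c = 1 \<or> orbit_index \<gamma> c = -1"
    using simple_closed_path_winding_number_inside[OF p(1)] cp(1) unfolding idx by metis
  obtain W where W: "open W" "simply_connected W" "inside (range \<gamma>) \<union> range \<gamma> \<subseteq> W"
    "\<And>z. z \<in> W \<Longrightarrow> z \<noteq> c \<Longrightarrow> f z \<noteq> 0"
    using neighbourhood_with_single_zero by blast
  have "c \<in> W" using W(3) c_inside by blast
  obtain G h where G: "G holomorphic_on W"
      and eq: "\<And>z. z \<in> W \<Longrightarrow> z \<noteq> c \<Longrightarrow> deriv f c / f z = 1 / (z - c) + deriv G z"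
    using linearizing_function[OF W(1,2) holomorphic_on_subset[OF holf] \<open>c \<in> W\<close> c0 deriv_nonzero_at_enclosed_zero W(4)]
    by (metis subset_UNIV)
  have pW: "path_image loop \<subseteq> W" using W(3) image by auto
  have "(G has_field_derivative deriv G z) (at z within W)" if "z \<in> W" for z
    using holomorphic_derivI[OF G W(1) that] .
  from Cauchy_theorem_primitive[OF this p(3) pW p(2)]
  have "(deriv G has_contour_integral 0) loop" .
  from has_contour_integral_add[OF has_contour_integral_winding_number[OF p(3) cp(2)] this]
  have "((\<lambda>z. 1 / (z - c) + deriv G z) has_contour_integral 2 * of_real pi * \<i> * winding_number loop c) loop"
    by simp
  then have 1: "((\<lambda>z. deriv f c / f z) has_contour_integral 2 * of_real pi * \<i> * winding_number loop c) loop"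
    by (rule has_contour_integral_eq) (rule eq[symmetric], use pW cp(2) in auto)
  have der: "vector_derivative loop (at s) = of_real period * f (loop s)" for s
    using orbit_loop_vector_derivative[OF holf orb] by (rule vector_derivative_at)
  have "deriv f c / f (loop s) * vector_derivative loop (at s) = deriv f c * of_real period" for s
  proof -
    have "f (loop s) \<noteq> 0" using periodic_orbit_nonzero[OF holf orb] by (simp add: orbit_loop_def)
    then show ?thesis by (simp add: der)
  qed
  then have 2: "((\<lambda>z. deriv f c / f z) has_contour_integral deriv f c * of_real period) loop"
    using has_integral_const_real[of "deriv f c * of_real period" 0 1] by (simp add: has_contour_integral)
  show "deriv f c * of_real period = 2 * of_real pi * \<i> * orbit_index \<gamma> c"
    using has_contour_integral_unique[OF 2 1] by (simp add: idx)
qed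

end

text \<open>The chart carries the linear field \<open>w' = f'(c) w\<close> on a disc to the field \<open>f\<close>. The derivative condition
  says so infinitesimally, which avoids speaking of the flow of \<open>f\<close> before solutions are known to
  exist; conversely the chart produces them.\<close>

definition linearizing_chart ::
    "(complex \<Rightarrow> complex) \<Rightarrow> complex \<Rightarrow> (complex \<Rightarrow> complex) \<Rightarrow> real \<Rightarrow> bool" where
  "linearizing_chart f c k R \<longleftrightarrow>
     k holomorphic_on ball 0 R \<and> inj_on k (ball 0 R) \<and> k 0 = c \<and>
     (\<forall>w\<in>ball 0 R. deriv k w * (deriv f c * w) = f (k w))"

text \<open>The linearizing function \<open>h\<close> maps the orbit bijectively to the circle of radius \<open>R\<close>, hence by the
  argument principle the inside bijectively to the disc. As \<open>h\<close> is then injective with nonvanishing derivative on the compact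
  closed inside, it is injective in a neighbourhood, and its inverse is defined on a slightly larger
  disc. The larger disc matters: its image is an open set containing the orbit itself.\<close>

theorem linearizing_chart_around_orbit:
  assumes holf: "f holomorphic_on UNIV" and around: "periodic_orbit_around f \<gamma> c" and c0: "f c = 0"
  obtains k R where "linearizing_chart f c k R" "range \<gamma> \<subseteq> k ` ball 0 R"
proof -
  define p where "p = orbit_loop \<gamma>"
  define T where "T = minimal_period \<gamma>"
  define l where "l = deriv f c"
  define w where "w = orbit_index \<gamma> c"
  have orb: "periodic_orbit f \<gamma>" and c_inside: "c \<in> inside (range \<gamma>)"
    using around by (simp_all add: periodic_orbit_around_def)
  have sol: "global_solution f \<gamma>" using orb by (simp add: periodic_orbit_def)
  note p = simple_path_orbit_loop[OF holf orb, folded p_def]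
    closed_orbit_loop[OF holf orb, folded p_def] valid_path_orbit_loop[OF holf orb, folded p_def]
  note image = path_image_orbit_loop[OF holf orb, folded p_def]
  have T: "T > 0" "is_period \<gamma> T"
    using minimal_period_is_period[OF holf orb] minimal_period_pos[OF holf orb] by (simp_all add: T_def)
  have lT: "l * of_real T = 2 * of_real pi * \<i> * w" and w: "w = 1 \<or> w = -1"
    using deriv_times_period[OF holf around c0] orbit_index_cases[OF holf around c0]
    by (simp_all add: l_def T_def w_def)
  define I where "I = inside (range \<gamma>)"
  define K where "K = I \<union> range \<gamma>"
  have I: "open I" "connected I" "frontier I = range \<gamma>" "closure I = K" "bounded I"
    using Jordan_inside_outside[OF p(1,2)] compact_closed_inside_of_simple_loop[OF p(1,2)]
    by (simp_all add: I_def K_def image)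
  have "compact K" using I by (metis compact_closure)
  have disj: "z \<notin> range \<gamma>" if "z \<in> I" for z
    using that inside_no_overlap[of "range \<gamma>"] unfolding I_def by blast
  obtain W where W: "open W" "simply_connected W" "K \<subseteq> W"
    "\<And>z. z \<in> W \<Longrightarrow> z \<noteq> c \<Longrightarrow> f z \<noteq> 0"
    using neighbourhood_with_single_zero[OF holf around c0] unfolding I_def K_def by blast
  have "c \<in> I" "c \<in> W" using c_inside W(3) by (auto simp: I_def K_def)
  obtain G h where holh: "h holomorphic_on W" and h: "\<And>z. h z = (z - c) * exp (G z)"
      and lin: "\<And>z. z \<in> W \<Longrightarrow> deriv h z * f z = l * h z" and reg: "\<And>z. z \<in> W \<Longrightarrow> deriv h z \<noteq> 0"
    using linearizing_function[OF W(1,2) holomorphic_on_subset[OF holf] \<open>c \<in> W\<close> c0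
        deriv_nonzero_at_enclosed_zero[OF holf around c0] W(4)]
    unfolding l_def by (metis subset_UNIV)
  have gW: "\<gamma> t \<in> W" for t using W(3) by (auto simp: K_def)
  have h\<gamma>: "h (\<gamma> t) = h (\<gamma> 0) * exp (l * of_real t)" for t
  proof -
    have "((\<lambda>t. h (\<gamma> t) * exp (- l * of_real t)) has_vector_derivative 0) (at t)" for t
    proof -
      have "((\<lambda>t. h (\<gamma> t)) has_vector_derivative f (\<gamma> t) * deriv h (\<gamma> t)) (at t)"
        using field_vector_diff_chain_at[of \<gamma> "f (\<gamma> t)" t h, OF _ holomorphic_derivI[OF holh W(1) gW]] sol
        by (simp add: global_solution_def o_def)
      moreover have "((\<lambda>t. exp (- l * of_real t)) has_vector_derivative exp (- l * of_real t) * - l) (at t)"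
        by (rule has_vector_derivative_real_field) (auto intro!: derivative_eq_intros)
      ultimately have "((\<lambda>t. h (\<gamma> t) * exp (- l * of_real t)) has_vector_derivative
          h (\<gamma> t) * (exp (- l * of_real t) * - l) + f (\<gamma> t) * deriv h (\<gamma> t) * exp (- l * of_real t)) (at t)"
        by (rule has_vector_derivative_mult)
      moreover have "h (\<gamma> t) * (exp (- l * of_real t) * - l) + f (\<gamma> t) * deriv h (\<gamma> t) * exp (- l * of_real t) = 0"
        using lin[OF gW, of t] by (simp add: algebra_simps)
      ultimately show ?thesis by simp
    qed
    then obtain a where "\<And>t. h (\<gamma> t) * exp (- l * of_real t) = a"
      using has_vector_derivative_zero_constant[of UNIV "\<lambda>t. h (\<gamma> t) * exp (- l * of_real t)"] by auto
    from this[of t] this[of 0] show ?thesis by (simp add: exp_minus field_simps)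
  qed
  have l_eq: "l = 2 * of_real pi * \<i> * w / of_real T" using lT T(1) by (simp add: field_simps)
  then have Re_l: "Re l = 0" using w by auto
  define R where "R = norm (h (\<gamma> 0))"
  have normh: "norm (h z) = R" if z: "z \<in> range \<gamma>" for z
  proof -
    obtain t where "z = \<gamma> t" using z by blast
    then show ?thesis using h\<gamma>[of t] by (simp add: R_def norm_mult Re_l)
  qed
  have "R > 0" using disj[OF \<open>c \<in> I\<close>] h by (force simp: R_def)
  have inj_range: "inj_on h (range \<gamma>)"
  proof (rule inj_onI, clarify)
    fix s t assume "h (\<gamma> s) = h (\<gamma> t)"
    then have "exp (l * of_real s) = exp (l * of_real t)"
      using \<open>R > 0\<close> by (simp add: h\<gamma>[of s] h\<gamma>[of t] R_def)
    then obtain n :: int where n: "l * of_real s = l * of_real t + (of_int (2 * n) * of_real pi) * \<i>"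
      unfolding exp_eq by auto
    then have "2 * of_real pi * \<i> * w * of_real s =
        2 * of_real pi * \<i> * w * of_real t + (of_int (2 * n) * of_real pi) * \<i> * of_real T"
      using T(1) by (simp add: l_eq field_simps)
    then have "\<i> * (2 * of_real pi) * (w * of_real s) = \<i> * (2 * of_real pi) * (w * of_real t + of_int n * of_real T)"
      by (simp add: algebra_simps)
    then have "w * of_real s = w * of_real t + of_int n * of_real T"
      by (subst (asm) mult_left_cancel) simp_all
    \<comment> \<open>here \<open>w\<close> is \<open>1\<close> or \<open>-1\<close>, so that the two times differ by a multiple of the period\<close>
    then have "of_real s = (of_real (t + of_int n * T) :: complex) \<or> of_real s = (of_real (t + of_int (- n) * T) :: complex)"
      using w by (auto simp: algebra_simps)
    then show "\<gamma> s = \<gamma> t"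
      unfolding of_real_eq_iff using is_period_of_int[OF T(2)] by metis
  qed
  have "\<not> h constant_on W"
  proof
    assume "h constant_on W"
    then have "h c = h (\<gamma> 0)" using \<open>c \<in> W\<close> gW unfolding constant_on_def by metis
    then show False using \<open>R > 0\<close> by (simp add: h R_def)
  qed
  have contK: "continuous_on K h" and holI: "h holomorphic_on I"
    using holomorphic_on_subset[OF holh] W(3)
    by (auto simp: K_def intro: holomorphic_on_imp_continuous_on)
  have hI: "h ` I \<subseteq> ball 0 R"
  proof -
    have "h ` I \<subseteq> cball 0 R"
    proof clarify
      fix z assume "z \<in> I"
      have "norm (h z) \<le> R"
        by (rule maximum_modulus_frontier[of h I])
           (use I contK holI normh \<open>z \<in> I\<close> in \<open>auto simp: interior_open\<close>)
      then show "h z \<in> cball 0 R" by simp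
    qed
    moreover have "open (h ` I)"
      using open_mapping_thm[OF holh W(1) _ I(1) _ \<open>\<not> h constant_on W\<close>] W(2,3)
      by (auto simp: K_def dest: simply_connected_imp_connected)
    ultimately have "h ` I \<subseteq> interior (cball 0 R)" by (rule interior_maximal)
    then show ?thesis by simp
  qed
  \<comment> \<open>the explicit logarithm of \<open>h \<circ> p\<close> gives its winding number\<close>
  have hp: "(h \<circ> p) = exp \<circ> (\<lambda>s. Ln (h (\<gamma> 0)) + 2 * of_real pi * \<i> * w * of_real s)"
  proof
    fix s
    have "l * of_real (s * T) = 2 * of_real pi * \<i> * w * of_real s"
      using lT by (simp add: mult.assoc[symmetric] mult.commute[of _ "of_real s"]) 
    then have "h (\<gamma> (s * T)) = h (\<gamma> 0) * exp (2 * of_real pi * \<i> * w * of_real s)"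
      using h\<gamma>[of "s * T"] by metis
    then show "(h \<circ> p) s = (exp \<circ> (\<lambda>s. Ln (h (\<gamma> 0)) + 2 * of_real pi * \<i> * w * of_real s)) s"
      using \<open>R > 0\<close> by (simp add: p_def orbit_loop_def T_def exp_add R_def)
  qed
  have wn0: "winding_number (h \<circ> p) 0 = w"
    unfolding hp by (subst winding_number_compose_exp)
      (auto simp: path_def pathfinish_def pathstart_def intro!: continuous_intros)
  have preimage: "\<exists>z. {z \<in> I. h z = \<zeta>} = {z}" if \<zeta>: "\<zeta> \<in> ball 0 R" for \<zeta>
  proof -
    have "path (h \<circ> p)"
      using valid_path_imp_path[OF p(3)] continuous_on_subset[OF contK, of "path_image p"]
      by (intro path_continuous_image) (auto simp: image K_def)
    moreover have "pathfinish (h \<circ> p) = pathstart (h \<circ> p)"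
      using p(2) by (simp add: pathfinish_compose pathstart_compose)
    ultimately have cpath: "path (h \<circ> p)" "pathfinish (h \<circ> p) = pathstart (h \<circ> p)" .
    have "path_image (h \<circ> p) \<subseteq> sphere 0 R"
      using normh by (auto simp: path_image_compose image)
    then have "winding_number (h \<circ> p) \<zeta> = winding_number (h \<circ> p) 0"
      by (intro winding_number_eq[OF cpath, of _ "ball 0 R"]) (use \<zeta> \<open>R > 0\<close> in auto)
    then have "winding_number ((\<lambda>z. h z - \<zeta>) \<circ> p) 0 = w"
      using winding_number_offset[of "h \<circ> p" \<zeta>] wn0 by (simp add: o_def)
    then have "norm (winding_number ((\<lambda>z. h z - \<zeta>) \<circ> p) 0) = 1" using w by auto
    moreover have "(\<lambda>z. h z - \<zeta>) holomorphic_on W" using holh by (intro holomorphic_intros)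
    moreover have "h z - \<zeta> \<noteq> 0" if "z \<in> path_image p" for z
      using that normh[of z] \<zeta> by (auto simp: image)
    moreover have "inside (path_image p) \<union> path_image p \<subseteq> W"
      using W(3) by (simp add: image I_def K_def)
    ultimately obtain z where "{z \<in> inside (path_image p). h z - \<zeta> = 0} = {z}"
      using unique_simple_zero_inside[OF p W(1)] by metis
    then show ?thesis by (auto simp: image I_def)
  qed
  have inj_K: "inj_on h K"
  proof (rule inj_onI)
    fix x y assume xy: "x \<in> K" "y \<in> K" "h x = h y"
    have small: "norm (h z) < R" if "z \<in> I" for z using hI that by auto
    consider "x \<in> I" "y \<in> I" | "x \<in> range \<gamma>" "y \<in> range \<gamma>"
      using xy small normh unfolding K_def by (metis Un_iff less_irrefl)
    then show "x = y"
    proof cases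
      case 1
      then have "h x \<in> ball 0 R" using hI by blast
      from preimage[OF this] obtain z where z: "{z \<in> I. h z = h x} = {z}" by blast
      have "x \<in> {z \<in> I. h z = h x}" "y \<in> {z \<in> I. h z = h x}" using 1 xy(3) by simp_all
      then show ?thesis unfolding z by simp
    next
      case 2
      then show ?thesis using inj_range xy(3) by (auto dest: inj_onD)
    qed
  qed
  obtain V where V: "open V" "K \<subseteq> V" "V \<subseteq> W" "inj_on h V"
    using injective_near_compact[OF holh W(1) \<open>compact K\<close> W(3) inj_K] reg W(3) by blast
  have holV: "h holomorphic_on V" using holh V(3) holomorphic_on_subset by blast
  have "open (h ` V)" using open_mapping_thm3[OF holV V(1,4)] .
  have "ball 0 R \<subseteq> h ` K"
  proof
    fix \<zeta> :: complex assume "\<zeta> \<in> ball 0 R"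
    from preimage[OF this] obtain z where "z \<in> I" "h z = \<zeta>" by blast
    then show "\<zeta> \<in> h ` K" by (auto simp: K_def)
  qed
  moreover have "compact (h ` K)"
    using \<open>compact K\<close> holV V(2)
    by (intro compact_continuous_image) (auto intro: holomorphic_on_imp_continuous_on holomorphic_on_subset)
  ultimately have "cball 0 R \<subseteq> h ` K"
    using \<open>R > 0\<close> closure_minimal[of "ball 0 R" "h ` K"] compact_imp_closed by fastforce
  then have "cball 0 R \<subseteq> h ` V" using V(2) by blast
  then obtain e where e: "e > 0" "(\<Union>x\<in>cball 0 R. ball x e) \<subseteq> h ` V"
    using compact_subset_open_imp_ball_epsilon_subset[OF compact_cball \<open>open (h ` V)\<close>] by metis
  have sub: "ball 0 (R + e) \<subseteq> h ` V"
  proof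
    fix z :: complex assume z: "z \<in> ball 0 (R + e)"
    show "z \<in> h ` V"
    proof (cases "norm z \<le> R")
      case True
      then show ?thesis using \<open>cball 0 R \<subseteq> h ` V\<close> by auto
    next
      case False
      have "z \<noteq> 0" using False \<open>R > 0\<close> by auto
      define x where "x = of_real (R / norm z) * z"
      have "z - x = of_real (1 - R / norm z) * z" by (simp add: x_def algebra_simps)
      then have "norm (z - x) = \<bar>1 - R / norm z\<bar> * norm z" by (metis norm_mult norm_of_real)
      also have "\<dots> = norm z - R" using False \<open>R > 0\<close> \<open>z \<noteq> 0\<close> by (simp add: abs_if field_simps)
      finally have "z \<in> ball x e" using z by (simp add: dist_norm norm_minus_commute)
      moreover have "x \<in> cball 0 R" using False \<open>R > 0\<close> by (auto simp: x_def norm_mult norm_divide)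
      ultimately show ?thesis using e(2) by blast
    qed
  qed
  obtain k where k: "k holomorphic_on h ` V" "\<And>z. z \<in> V \<Longrightarrow> deriv h z * deriv k (h z) = 1"
      "\<And>z. z \<in> V \<Longrightarrow> k (h z) = z"
    using holomorphic_has_inverse[OF holV V(1,4)] by metis
  have "linearizing_chart f c k (R + e)"
    unfolding linearizing_chart_def
  proof (intro conjI ballI)
    show "k holomorphic_on ball 0 (R + e)" using k(1) sub holomorphic_on_subset by blast
    show "inj_on k (ball 0 (R + e))"
      by (rule inj_on_subset[OF _ sub]) (auto simp: inj_on_def k(3))
    show "k 0 = c" using k(3)[of c] \<open>c \<in> I\<close> V(2) h[of c] by (auto simp: K_def)
    fix z :: complex assume "z \<in> ball 0 (R + e)"
    then obtain y where y: "y \<in> V" "z = h y" using sub by blast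
    have "deriv k z * (l * z) = deriv k (h y) * (deriv h y * f y)"
      using y lin[of y] V(3) by auto
    also have "\<dots> = f (k z)" using k(2)[OF y(1)] k(3)[OF y(1)] y(2) by (simp add: algebra_simps)
    finally show "deriv k z * (deriv f c * z) = f (k z)" by (simp add: l_def)
  qed
  moreover have "range \<gamma> \<subseteq> k ` ball 0 (R + e)"
  proof
    fix z assume "z \<in> range \<gamma>"
    then have "h z \<in> ball 0 (R + e)" "k (h z) = z"
      using normh[of z] e(1) k(3)[of z] V(2) by (auto simp: K_def)
    then show "z \<in> k ` ball 0 (R + e)" by force
  qed
  ultimately show ?thesis using that by blast
qed

section \<open>Orbits in a linearizing chart\<close>

text \<open>All three parts are read off from \<open>f'(c) T = 2\<pi>\<i> ind\<close> with \<open>ind = \<plusminus>1\<close>. They show that the period and the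
  index depend only on \<open>c\<close>, not on the orbit.\<close>

lemma enclosed_zero_multiplier:
  assumes "f holomorphic_on UNIV" "periodic_orbit_around f \<gamma> c" "f c = 0"
  shows "Re (deriv f c) = 0" and "norm (deriv f c) * minimal_period \<gamma> = 2 * pi"
    and "orbit_index \<gamma> c = of_real (sgn (Im (deriv f c)))"
proof -
  define T where "T = minimal_period \<gamma>"
  have T: "T > 0"
    using assms minimal_period_pos by (simp add: T_def periodic_orbit_around_def)
  have eq: "deriv f c * of_real T = 2 * of_real pi * \<i> * orbit_index \<gamma> c"
    and cases: "orbit_index \<gamma> c = 1 \<or> orbit_index \<gamma> c = -1"
    using deriv_times_period[OF assms] orbit_index_cases[OF assms] by (simp_all add: T_def)
  have "norm (deriv f c * of_real T) = 2 * pi"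
    unfolding eq using cases by (auto simp: norm_mult)
  then show "norm (deriv f c) * minimal_period \<gamma> = 2 * pi"
    using T by (simp add: norm_mult T_def)
  have "Re (deriv f c * of_real T) = 0" unfolding eq using cases by auto
  then show "Re (deriv f c) = 0" using T by simp
  have Im: "Im (deriv f c) * T = 2 * pi * Re (orbit_index \<gamma> c)"
    using arg_cong[OF eq, of Im] cases by auto
  from cases show "orbit_index \<gamma> c = of_real (sgn (Im (deriv f c)))"
  proof
    assume 1: "orbit_index \<gamma> c = 1"
    then have "0 < Im (deriv f c) * T" using Im by simp
    then show ?thesis using 1 T by (simp add: zero_less_mult_iff)
  next
    assume 1: "orbit_index \<gamma> c = -1"
    then have "Im (deriv f c) * T < 0" using Im by simp
    then show ?thesis using 1 T by (simp add: mult_less_0_iff)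
  qed
qed

text \<open>The factor \<open>d\<close> is a complex direction of time; \<open>d = 1\<close> gives the solutions of \<open>z' = f(z)\<close>.\<close>

lemma linearizing_chart_flow:
  assumes chart: "linearizing_chart f c k R" and "w * exp (deriv f c * d * of_real t) \<in> ball 0 R"
  shows "((\<lambda>t. k (w * exp (deriv f c * d * of_real t))) has_vector_derivative
           d * f (k (w * exp (deriv f c * d * of_real t)))) (at t)"
proof -
  let ?e = "\<lambda>t. w * exp (deriv f c * d * of_real t)"
  have "(?e has_vector_derivative ?e t * (deriv f c * d)) (at t)"
    by (rule has_vector_derivative_real_field) (auto intro!: derivative_eq_intros)
  moreover have "(k has_field_derivative deriv k (?e t)) (at (?e t))"
    using chart assms(2) by (intro holomorphic_derivI[of _ "ball 0 R"]) (auto simp: linearizing_chart_def)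
  ultimately have "(k \<circ> ?e has_vector_derivative ?e t * (deriv f c * d) * deriv k (?e t)) (at t)"
    by (rule field_vector_diff_chain_at)
  moreover have "deriv k (?e t) * (deriv f c * ?e t) = f (k (?e t))"
    using chart assms(2) unfolding linearizing_chart_def by blast
  then have "?e t * (deriv f c * d) * deriv k (?e t) = d * f (k (?e t))"
    by (simp add: algebra_simps)
  ultimately show ?thesis by (simp add: o_def)
qed

text \<open>The image of the open disc is open, bounded, and bordered by the image of the circle, so the component
  of \<open>k 0\<close> in the complement of the latter cannot leave it.\<close>

lemma in_inside_of_chart_circle:
  assumes k: "k holomorphic_on ball 0 R" "inj_on k (ball 0 R)" and r: "0 < r" "r < R"
  shows "k 0 \<in> inside (k ` sphere 0 r)"
proof -
  have contk: "continuous_on A k" if "A \<subseteq> ball 0 R" for A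
    using that k holomorphic_on_subset holomorphic_on_imp_continuous_on by blast
  have B: "ball 0 r \<subseteq> ball (0::complex) R" "cball 0 r \<subseteq> ball (0::complex) R" using r by auto
  have op: "open (k ` ball 0 r)"
    using B k by (intro open_mapping_thm3) (auto intro: holomorphic_on_subset inj_on_subset)
  have cl: "compact (k ` cball 0 r)"
    using contk[OF B(2)] by (intro compact_continuous_image) auto
  define C where "C = connected_component_set (- k ` sphere 0 r) (k 0)"
  have split: "k ` cball 0 r = k ` ball 0 r \<union> k ` sphere 0 r"
    unfolding image_Un[symmetric] by (rule arg_cong[where f = "image k"]) auto
  have k0: "k 0 \<notin> k ` sphere 0 r"
  proof
    assume "k 0 \<in> k ` sphere 0 r"
    then obtain y where "y \<in> sphere 0 r" "k 0 = k y" by blast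
    then have "y = 0" using inj_onD[OF k(2), of 0 y] r by auto
    then show False using \<open>y \<in> sphere 0 r\<close> r by simp
  qed
  have sub: "C \<subseteq> - k ` sphere 0 r" unfolding C_def by (rule connected_component_subset)
  have "k 0 \<in> C" using k0 by (simp add: C_def)
  have "C \<subseteq> k ` ball 0 r"
  proof (rule ccontr)
    assume "\<not> C \<subseteq> k ` ball 0 r"
    then obtain y where y: "y \<in> C" "y \<notin> k ` ball 0 r" by blast
    then have "y \<in> - k ` cball 0 r" using sub split by blast
    moreover have "k 0 \<in> k ` ball 0 r" using r by simp
    moreover have "connected C" by (simp add: C_def)
    moreover have "k ` ball 0 r \<inter> - k ` cball 0 r \<inter> C = {}" unfolding split by blast
    moreover have "C \<subseteq> k ` ball 0 r \<union> - k ` cball 0 r" using sub unfolding split by blast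
    moreover have "open (- k ` cball 0 r)" using cl compact_imp_closed by blast
    ultimately show False
      using connectedD[OF \<open>connected C\<close> op, of "- k ` cball 0 r"] \<open>k 0 \<in> C\<close> y(1) by blast
  qed
  then have "bounded C"
    using compact_imp_bounded[OF cl] unfolding split by (meson bounded_subset sup_ge1)
  then show ?thesis using k0 by (simp add: inside_def C_def)
qed

text \<open>With an imaginary multiplier the circles around \<open>0\<close> are invariant under the linear flow, and their images
  are periodic orbits.\<close>

lemma linearizing_chart_image:
  assumes chart: "linearizing_chart f c k R" and l: "Re (deriv f c) = 0" "deriv f c \<noteq> 0"
  shows "k ` ball 0 R \<subseteq> center_region f c"
proof
  fix z assume "z \<in> k ` ball 0 R"
  then obtain w where w: "w \<in> ball 0 R" "z = k w" by blast
  have k: "k holomorphic_on ball 0 R" "inj_on k (ball 0 R)" "k 0 = c"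
    using chart by (auto simp: linearizing_chart_def)
  show "z \<in> center_region f c"
  proof (cases "w = 0")
    case True
    then show ?thesis using w k by (simp add: center_region_def)
  next
    case False
    define l where "l = deriv f c"
    define b where "b = Im l"
    have l_eq: "l = \<i> * of_real b" and "b \<noteq> 0"
      using assms(2,3) by (auto simp: l_def b_def complex_eq_iff)
    define r where "r = norm w"
    have r: "0 < r" "r < R" using w False by (auto simp: r_def)
    define \<delta> where "\<delta> = (\<lambda>t. k (w * exp (l * 1 * of_real t)))"
    have norm: "norm (w * exp (l * 1 * of_real t)) = r" for t
      by (simp add: norm_mult l_eq r_def)
    have "global_solution f \<delta>"
      unfolding global_solution_def
    proof
      fix t show "(\<delta> has_vector_derivative f (\<delta> t)) (at t)"
        using linearizing_chart_flow[OF chart, of w 1 t] norm[of t] r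
        by (simp add: \<delta>_def l_def)
    qed
    moreover have "is_period \<delta> (2 * pi / \<bar>b\<bar>)"
      unfolding is_period_def
    proof (intro conjI allI)
      show "0 < 2 * pi / \<bar>b\<bar>" using \<open>b \<noteq> 0\<close> by simp
      fix t
      have "l * of_real (2 * pi / \<bar>b\<bar>) = \<i> * of_real (2 * pi * sgn b)"
        using \<open>b \<noteq> 0\<close> by (simp add: l_eq sgn_if)
      then have "exp (l * of_real (2 * pi / \<bar>b\<bar>)) = 1"
        using \<open>b \<noteq> 0\<close> by (auto simp: exp_eq_1 sgn_if intro: exI[of _ "1::int"] exI[of _ "-1::int"])
      then show "\<delta> (t + 2 * pi / \<bar>b\<bar>) = \<delta> t"
        by (simp add: \<delta>_def distrib_left exp_add)
    qed
    moreover have circle: "range \<delta> = k ` sphere 0 r"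
    proof (rule subset_antisym)
      show "range \<delta> \<subseteq> k ` sphere 0 r" using norm by (auto simp: \<delta>_def)
      show "k ` sphere 0 r \<subseteq> range \<delta>"
      proof clarify
        fix y :: complex assume "y \<in> sphere 0 r"
        then have "norm (y / w) = 1" using r by (simp add: norm_divide r_def)
        then obtain \<theta> where "exp (\<i> * of_real \<theta>) = y / w"
          using complex_norm_eq_1_exp by blast
        then have "y = w * exp (l * of_real (\<theta> / b))"
          using False \<open>b \<noteq> 0\<close> by (simp add: l_eq field_simps)
        then have "k y = \<delta> (\<theta> / b)" by (simp add: \<delta>_def)
        then show "k y \<in> range \<delta>" by blast
      qed
    qed
    moreover have "\<not> \<delta> constant_on UNIV"
    proof
      assume "\<delta> constant_on UNIV"
      then obtain a where "range \<delta> \<subseteq> {a}" by (auto simp: constant_on_def)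
      moreover have "k w \<in> range \<delta>" "k (- w) \<in> range \<delta>" by (auto simp: circle r_def)
      ultimately have "k w = k (- w)" by blast
      then have "w = - w" using inj_onD[OF k(2), of w "- w"] w by simp
      then show False using False by (simp add: complex_eq_iff)
    qed
    moreover have "c \<in> inside (range \<delta>)"
      unfolding circle using in_inside_of_chart_circle[OF k(1,2) r] k(3) by simp
    ultimately have "periodic_orbit_around f \<delta> c"
      by (auto simp: periodic_orbit_around_def periodic_orbit_def)
    moreover have "\<delta> 0 = z" by (simp add: \<delta>_def w)
    ultimately show ?thesis by (auto simp: center_region_def)
  qed
qed

section \<open>Regions of centers\<close>

text \<open>Every point of the region other than \<open>c\<close> lies on an orbit and thus in the open image of a chart, which
  is contained in the region.\<close>

lemma
  assumes holf: "f holomorphic_on UNIV" and center: "is_center f c"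
  shows center_zero: "f c = 0"
    and center_deriv: "Re (deriv f c) = 0" "deriv f c \<noteq> 0"
    and open_center_region: "open (center_region f c)"
    and chart_at_region_point:
      "\<And>w. w \<in> center_region f c \<Longrightarrow> w \<noteq> c \<Longrightarrow> \<exists>k R. linearizing_chart f c k R \<and> w \<in> k ` ball 0 R"
proof -
  obtain r where r: "r > 0" "\<And>w. w \<in> ball c r - {c} \<Longrightarrow> \<exists>\<gamma>. periodic_orbit_around f \<gamma> c \<and> \<gamma> 0 = w"
    using center unfolding is_center_def by blast
  show c0: "f c = 0" using center by (simp add: is_center_def)
  have "c + of_real (r / 2) \<in> ball c r - {c}" using r(1) by (simp add: dist_norm)
  then obtain \<gamma> where \<gamma>: "periodic_orbit_around f \<gamma> c" using r(2) by blast
  show l: "Re (deriv f c) = 0" "deriv f c \<noteq> 0"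
    using enclosed_zero_multiplier(1)[OF holf \<gamma> c0] deriv_nonzero_at_enclosed_zero[OF holf \<gamma> c0] by auto
  show chart: "\<exists>k R. linearizing_chart f c k R \<and> w \<in> k ` ball 0 R" if w: "w \<in> center_region f c" "w \<noteq> c" for w
  proof -
    obtain \<gamma> where "periodic_orbit_around f \<gamma> c" "\<gamma> 0 = w" using w by (auto simp: center_region_def)
    then show ?thesis using linearizing_chart_around_orbit[OF holf _ c0] by (metis rangeI subsetD)
  qed
  show "open (center_region f c)"
    unfolding open_subopen[of "center_region f c"]
  proof
    fix w assume w: "w \<in> center_region f c"
    show "\<exists>T. open T \<and> w \<in> T \<and> T \<subseteq> center_region f c"
    proof (cases "w = c")
      case True
      have "ball c r \<subseteq> center_region f c" using r(2) by (auto simp: center_region_def)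
      then show ?thesis using True r(1) by (intro exI[of _ "ball c r"]) auto
    next
      case False
      then obtain k R where k: "linearizing_chart f c k R" "w \<in> k ` ball 0 R" using chart w by blast
      then have "open (k ` ball 0 R)"
        by (intro open_mapping_thm3) (auto simp: linearizing_chart_def)
      then show ?thesis using k linearizing_chart_image[OF k(1) l] by blast
    qed
  qed
qed

text \<open>A common point would lie on one orbit that encloses both zeros.\<close>

lemma center_regions_disjoint:
  assumes holf: "f holomorphic_on UNIV" and "f a = 0" "f b = 0" "a \<noteq> b"
  shows "center_region f a \<inter> center_region f b = {}"
proof (rule ccontr)
  assume "center_region f a \<inter> center_region f b \<noteq> {}"
  then obtain w where w: "w \<in> center_region f a" "w \<in> center_region f b" by blast
  have nz: "f x \<noteq> 0" if "periodic_orbit_around f \<gamma> c" "\<gamma> 0 = x" for \<gamma> c x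
    using that periodic_orbit_nonzero[OF holf] by (auto simp: periodic_orbit_around_def)
  have "w \<noteq> a" "w \<noteq> b" using w assms nz by (auto simp: center_region_def)
  then obtain \<gamma> \<delta> where \<gamma>: "periodic_orbit_around f \<gamma> a" "\<gamma> 0 = w"
    and \<delta>: "periodic_orbit_around f \<delta> b" "\<delta> 0 = w"
    using w by (auto simp: center_region_def)
  then have "\<gamma> = \<delta>"
    using global_solution_unique[OF holf, of \<gamma> \<delta> 0]
    by (auto simp: periodic_orbit_around_def periodic_orbit_def)
  then have "b \<in> inside (range \<gamma>)" using \<delta> by (simp add: periodic_orbit_around_def)
  then show False using only_zero_inside_orbit[OF holf \<gamma>(1)] assms by blast
qed

section \<open>The boundary of a region\<close>

text \<open>Near a zero \<open>z\<close> of \<open>f\<close> the flow is slow: by Gronwall's inequality the distance to \<open>z\<close> grows at most by the factor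
  \<open>e\<^sup>L\<^sup>T\<close> during the time \<open>T\<close>. As all orbits of the region have the same period \<open>T\<close>, an orbit
  that starts close enough to \<open>z\<close> remains in a disc around \<open>z\<close> with \<open>c\<close> on its rim, and therefore
  cannot enclose \<open>c\<close>.\<close>

lemma field_nonzero_on_frontier:
  assumes holf: "f holomorphic_on UNIV" and center: "is_center f c" and z: "z \<in> frontier (center_region f c)"
  shows "f z \<noteq> 0"
proof
  assume fz: "f z = 0"
  note c0 = center_zero[OF holf center] and l = center_deriv[OF holf center]
  have "z \<noteq> c"
    using z open_center_region[OF holf center]
    by (auto simp: frontier_def interior_open center_region_def)
  define T where "T = 2 * pi / norm (deriv f c)"
  have "T > 0" using l by (simp add: T_def)
  define \<rho> where "\<rho> = dist z c"
  have "\<rho> > 0" using \<open>z \<noteq> c\<close> by (simp add: \<rho>_def)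
  have dF: "(f has_field_derivative deriv f x) (at x)" for x
    using holf holomorphic_derivI by blast
  have "compact (deriv f ` cball z \<rho>)"
    using holf by (intro compact_continuous_image holomorphic_on_imp_continuous_on) 
      (auto intro: holomorphic_on_subset[OF holomorphic_deriv])
  then obtain L where L: "L > 0" "\<And>x. x \<in> deriv f ` cball z \<rho> \<Longrightarrow> norm x \<le> L"
    using compact_imp_bounded bounded_pos by metis
  have bd: "norm (f x) \<le> L * norm (x - z)" if "x \<in> cball z \<rho>" for x
    using field_differentiable_bound[of "cball z \<rho>" f "deriv f" L x z] that L(2) fz \<open>\<rho> > 0\<close>
    by (auto intro: has_field_derivative_at_within[OF dF])
  obtain x where x: "x \<in> center_region f c" "dist x z < \<rho> * exp (- L * T)"
    using z \<open>\<rho> > 0\<close> unfolding frontier_def closure_approachable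
    by (metis DiffD1 closure_approachable exp_gt_zero mult_pos_pos)
  have small: "norm (x - z) * exp (L * T) < \<rho>"
    using x(2) by (simp add: dist_norm exp_minus field_simps)
  have "exp (- L * T) \<le> 1" using L \<open>T > 0\<close> by simp
  then have "dist x z < \<rho>" using x(2) \<open>\<rho> > 0\<close> by (smt (verit) mult_left_le)
  then have "x \<noteq> c" by (auto simp: \<rho>_def dist_commute)
  then obtain \<gamma> where \<gamma>: "periodic_orbit_around f \<gamma> c" "\<gamma> 0 = x" using x by (auto simp: center_region_def)
  then have orb: "periodic_orbit f \<gamma>" and sol: "global_solution f \<gamma>" and inside: "c \<in> inside (range \<gamma>)"
    by (auto simp: periodic_orbit_around_def periodic_orbit_def)
  have "minimal_period \<gamma> = T"
    using enclosed_zero_multiplier(2)[OF holf \<gamma>(1) c0] l by (simp add: T_def field_simps)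
  then have T: "is_period \<gamma> T"
    using minimal_period_is_period[OF holf orb] by simp
  have contg: "continuous_on A \<gamma>" for A
    using sol unfolding global_solution_def
    by (meson continuous_at_imp_continuous_on has_vector_derivative_continuous)
  have near: "norm (\<gamma> t - z) < \<rho>" if t: "t \<in> {0..T}" for t
  proof (rule ccontr)
    assume far: "\<not> norm (\<gamma> t - z) < \<rho>"
    \<comment> \<open>\<open>Inf S\<close> is the first time at which the orbit reaches the rim; until then the estimate for \<open>f\<close> is available\<close>
    define S where "S = {s \<in> {0..t}. \<rho> \<le> norm (\<gamma> s - z)}"
    have "closed ({0..t} \<inter> {s. \<rho> \<le> norm (\<gamma> s - z)})"
      by (intro closed_Int closed_atLeastAtMost closed_Collect_le continuous_intros contg)
    also have "{0..t} \<inter> {s. \<rho> \<le> norm (\<gamma> s - z)} = S" by (auto simp: S_def)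
    finally have "closed S" .
    moreover have "t \<in> S" using far t by (simp add: S_def)
    moreover have "bdd_below S" by (rule bdd_belowI[of _ 0]) (simp add: S_def)
    ultimately have s: "Inf S \<in> S" "\<And>s. s \<in> S \<Longrightarrow> Inf S \<le> s"
      using closed_contains_Inf[of S] cInf_lower[of _ S] by auto
    define s where "s = Inf S"
    have s: "s \<in> S" "\<And>s'. s' \<in> S \<Longrightarrow> s \<le> s'" using s by (simp_all add: s_def)
    then have s0: "0 \<le> s" "s \<le> T" using t by (auto simp: S_def)
    have "norm (\<gamma> u - z) \<le> \<rho>" if u: "u \<in> {0..s}" for u
    proof -
      have "s \<noteq> 0" using s(1) \<gamma>(2) \<open>dist x z < \<rho>\<close> by (auto simp: S_def dist_norm)
      have "{0..<s} \<subseteq> {u. norm (\<gamma> u - z) \<le> \<rho>}"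
        using s by (fastforce simp: S_def)
      moreover have "closed {u. norm (\<gamma> u - z) \<le> \<rho>}"
        by (intro closed_Collect_le continuous_intros contg)
      ultimately have "closure {0..<s} \<subseteq> {u. norm (\<gamma> u - z) \<le> \<rho>}"
        by (rule closure_minimal)
      then show ?thesis using u \<open>s \<noteq> 0\<close> s0 by auto
    qed
    then have "norm (f (\<gamma> u)) \<le> L * norm (\<gamma> u - z)" if "u \<in> {0..s}" for u
      using that bd[of "\<gamma> u"] by (simp add: dist_norm norm_minus_commute)
    then have "norm (\<gamma> s - z) \<le> norm (\<gamma> 0 - z) * exp (L * (s - 0))"
      using sol s0 by (intro norm_le_exp_of_linear_growth[where v = "\<lambda>u. f (\<gamma> u)"])
        (auto simp: global_solution_def intro!: derivative_eq_intros)
    also have "\<dots> \<le> norm (x - z) * exp (L * T)"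
      using \<gamma>(2) s0 L by (intro mult_mono) auto
    also have "\<dots> < \<rho>" by (rule small)
    finally show False using s(1) by (simp add: S_def)
  qed
  have "range \<gamma> \<subseteq> ball z \<rho>"
  proof clarify
    fix t
    have "\<gamma> t = \<gamma> (frac (t / T) * T)" by (rule is_period_frac[OF T])
    moreover have "frac (t / T) * T \<in> {0..T}"
      using \<open>T > 0\<close> frac_ge_0[of "t / T"] frac_lt_1[of "t / T"] by (auto simp: mult_le_cancel_right1)
    ultimately show "\<gamma> t \<in> ball z \<rho>" using near by (simp add: dist_norm norm_minus_commute)
  qed
  then have "- ball z \<rho> \<subseteq> outside (range \<gamma>)"
    by (rule outside_subset_convex[OF convex_ball])
  then have "c \<in> outside (range \<gamma>)" by (auto simp: \<rho>_def)
  then show False using inside inside_Int_outside[of "range \<gamma>"] by blast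
qed

text \<open>Moving from \<open>\<zeta>\<close> to \<open>\<xi>\<close> in complex time corresponds in the chart to multiplication by
  \<open>exp (f'(c) (\<xi> - \<zeta>))\<close>. Since \<open>f'(c)\<close> is imaginary, the sign condition says that this factor has
  modulus at most \<open>1\<close>, and likewise at all intermediate times, so the motion does not leave the disc
  of the chart.\<close>

lemma region_propagates_along_chart:
  assumes holf: "f holomorphic_on UNIV" and center: "is_center f c"
    and g: "\<And>\<zeta>. \<zeta> \<in> S \<Longrightarrow> (g has_field_derivative f (g \<zeta>)) (at \<zeta>)"
    and seg: "closed_segment \<zeta> \<xi> \<subseteq> S" and sign: "0 \<le> Im (deriv f c) * Im (\<xi> - \<zeta>)"
    and start: "g \<zeta> \<in> center_region f c" "g \<zeta> \<noteq> c"
  shows "g \<xi> \<in> center_region f c"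
proof -
  note l = center_deriv[OF holf center]
  obtain k R where k: "linearizing_chart f c k R" "g \<zeta> \<in> k ` ball 0 R"
    using chart_at_region_point[OF holf center] start by blast
  then obtain w where w: "w \<in> ball 0 R" "g \<zeta> = k w" by blast
  define d where "d = \<xi> - \<zeta>"
  define e where "e = (\<lambda>t::real. w * exp (deriv f c * d * of_real t))"
  have e: "e t \<in> ball 0 R" if "t \<in> {0..1}" for t
  proof -
    have "Re (deriv f c * d * of_real t) \<le> 0"
      using l sign that by (simp add: d_def)
    then have "norm (e t) \<le> norm w" by (simp add: e_def norm_mult mult_left_le)
    then show ?thesis using w by simp
  qed
  have "g (\<zeta> + of_real 1 * d) = k (e 1)"
  proof (rule holomorphic_ode_unique[where F = "\<lambda>z. d * f z"
        and x = "\<lambda>t. g (\<zeta> + of_real t * d)" and y = "\<lambda>t. k (e t)"])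
    show "(\<lambda>z. d * f z) holomorphic_on UNIV" using holf by (intro holomorphic_intros)
    show "g (\<zeta> + of_real 0 * d) = k (e 0)" using w by (simp add: e_def)
    fix t :: real assume t: "t \<in> {0..1}"
    have "\<zeta> + of_real t * d \<in> closed_segment \<zeta> \<xi>"
      using t by (auto simp: in_segment d_def scaleR_conv_of_real algebra_simps intro!: exI[of _ t])
    then have "(g has_field_derivative f (g (\<zeta> + of_real t * d))) (at (\<zeta> + of_real t * d))"
      using g seg by blast
    moreover have "((\<lambda>t. \<zeta> + of_real t * d) has_vector_derivative d) (at t)"
      by (rule has_vector_derivative_real_field) (auto intro!: derivative_eq_intros)
    ultimately show "((\<lambda>t. g (\<zeta> + of_real t * d)) has_vector_derivative d * f (g (\<zeta> + of_real t * d))) (at t)"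
      using field_vector_diff_chain_at[of "\<lambda>t. \<zeta> + of_real t * d" d t g] by (simp add: o_def)
    show "((\<lambda>t. k (e t)) has_vector_derivative d * f (k (e t))) (at t)"
      using linearizing_chart_flow[OF k(1), of w d t] e[OF t] by (simp add: e_def)
  qed
  then have "g \<xi> = k (e 1)" by (simp add: d_def)
  then show ?thesis using linearizing_chart_image[OF k(1) l] e[of 1] by auto
qed

text \<open>Near a point where \<open>f\<close> does not vanish, complex time is a primitive of \<open>1/f\<close>; \<open>g\<close> is its local
  inverse.\<close>

lemma complex_time_flow:
  assumes holf: "f holomorphic_on UNIV" and "f z \<noteq> 0"
  obtains g r where "r > 0" "g 0 = z" "\<And>\<zeta>. \<zeta> \<in> ball 0 r \<Longrightarrow> (g has_field_derivative f (g \<zeta>)) (at \<zeta>)"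
    "\<And>A. open A \<Longrightarrow> A \<subseteq> ball 0 r \<Longrightarrow> open (g ` A)"
proof -
  have "open {x. f x \<noteq> 0}"
    using holomorphic_on_imp_continuous_on[OF holf] by (intro open_Collect_neq) auto
  then obtain s where "s > 0" "ball z s \<subseteq> {x. f x \<noteq> 0}"
    by (rule openE[of _ z]) (use \<open>f z \<noteq> 0\<close> in auto)
  then have s: "s > 0" "\<And>x. x \<in> ball z s \<Longrightarrow> f x \<noteq> 0" by auto
  have "(\<lambda>x. 1 / f x) holomorphic_on ball z s"
    using holf s(2) by (intro holomorphic_intros) (auto intro: holomorphic_on_subset)
  then obtain F where F: "\<And>x. x \<in> ball z s \<Longrightarrow> (F has_field_derivative 1 / f x) (at x)"
    using holomorphic_convex_primitive'[of "ball z s" "\<lambda>x. 1 / f x"]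
    by (metis at_within_open convex_ball open_ball)
  have holF: "F holomorphic_on ball z s"
    unfolding holomorphic_on_open[OF open_ball] using F by blast
  have dF: "deriv F x = 1 / f x" if "x \<in> ball z s" for x
    using F[OF that] by (rule DERIV_imp_deriv)
  obtain q where q: "q > 0" "ball z q \<subseteq> ball z s" "inj_on F (ball z q)"
    using has_complex_derivative_locally_injective[OF holF _ open_ball, of z] s dF[of z] by auto
  have holFq: "F holomorphic_on ball z q" using holF q(2) holomorphic_on_subset by blast
  obtain G where G: "G holomorphic_on F ` ball z q" "\<And>x. x \<in> ball z q \<Longrightarrow> deriv F x * deriv G (F x) = 1"
      "\<And>x. x \<in> ball z q \<Longrightarrow> G (F x) = x"
    using holomorphic_has_inverse[OF holFq open_ball q(3)] by metis
  have opF: "open (F ` ball z q)" using open_mapping_thm3[OF holFq open_ball q(3)] .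
  moreover have "F z \<in> F ` ball z q" using q(1) by simp
  ultimately obtain r where r: "r > 0" "ball (F z) r \<subseteq> F ` ball z q" by (meson open_contains_ball)
  define g where "g = (\<lambda>\<zeta>. G (F z + \<zeta>))"
  have sub: "F z + \<zeta> \<in> F ` ball z q" if "\<zeta> \<in> ball 0 r" for \<zeta>
    using that r(2) by (auto simp: dist_norm)
  have dg: "(g has_field_derivative f (g \<zeta>)) (at \<zeta>)" if \<zeta>: "\<zeta> \<in> ball 0 r" for \<zeta>
  proof -
    obtain x where x: "x \<in> ball z q" "F z + \<zeta> = F x" using sub[OF \<zeta>] by blast
    have G': "(G has_field_derivative deriv G (F x)) (at (F z + \<zeta>))"
      using holomorphic_derivI[OF G(1) opF] x by auto
    have "((\<lambda>\<zeta>. F z + \<zeta>) has_field_derivative 1) (at \<zeta>)"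
      by (auto intro!: derivative_eq_intros)
    from DERIV_chain'[OF this G'] have "(g has_field_derivative deriv G (F x)) (at \<zeta>)"
      by (simp add: g_def)
    moreover have "deriv G (F x) = f x"
    proof -
      have "x \<in> ball z s" using x(1) q(2) by blast
      then show ?thesis using G(2)[OF x(1)] dF[of x] s(2)[of x] by (simp add: field_simps)
    qed
    moreover have "f (g \<zeta>) = f x" using G(3)[OF x(1)] x(2) by (simp add: g_def)
    ultimately show ?thesis
      by simp
  qed
  have holg: "g holomorphic_on ball 0 r"
    unfolding holomorphic_on_open[OF open_ball] using dg by blast
  have "inj_on g (ball 0 r)"
  proof (rule inj_onI)
    fix a b assume ab: "a \<in> ball 0 r" "b \<in> ball 0 r" "g a = g b"
    obtain x y where "x \<in> ball z q" "F z + a = F x" "y \<in> ball z q" "F z + b = F y"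
      using sub[OF ab(1)] sub[OF ab(2)] by blast
    then show "a = b" using ab(3) G(3) by (metis add_left_cancel g_def)
  qed
  then have "open (g ` A)" if "open A" "A \<subseteq> ball 0 r" for A
    using that holg by (meson holomorphic_on_subset inj_on_subset open_mapping_thm3)
  moreover have "g 0 = z" using G(3)[of z] q(1) by (simp add: g_def)
  ultimately show ?thesis using that[of r g] r(1) dg by blast
qed

text \<open>If both imaginary parts had the sign \<open>\<sigma>\<close>, then complex time could be moved in the direction
  \<open>\<sigma>\<i>\<close> without leaving either region. Starting close to \<open>z\<close>, that is at times \<open>\<zeta>\<close> with
  \<open>\<bar>\<zeta>\<bar> < r/2\<close>, one reaches the same time \<open>\<xi> = \<sigma>\<i>r/2\<close> from both regions.\<close>

theorem neighbouring_centers_rotate_oppositely: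
  assumes holf: "f holomorphic_on UNIV" and "a \<noteq> b" and ca: "is_center f a" and cb: "is_center f b"
    and z: "z \<in> frontier (center_region f a)" "z \<in> frontier (center_region f b)"
  shows "sgn (Im (deriv f a)) * sgn (Im (deriv f b)) = -1"
proof (rule ccontr)
  assume neg: "sgn (Im (deriv f a)) * sgn (Im (deriv f b)) \<noteq> -1"
  have "Im (deriv f a) \<noteq> 0" "Im (deriv f b) \<noteq> 0"
    using center_deriv[OF holf ca] center_deriv[OF holf cb] by (auto simp: complex_eq_iff)
  with neg obtain \<sigma> :: real where \<sigma>: "\<bar>\<sigma>\<bar> = 1" "\<sigma> * Im (deriv f a) > 0" "\<sigma> * Im (deriv f b) > 0"
    by (rule_tac that[of "sgn (Im (deriv f a))"]) (auto simp: sgn_if split: if_splits)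
  have fz: "f z \<noteq> 0" using field_nonzero_on_frontier[OF holf ca z(1)] .
  obtain g r where r: "r > 0" "g 0 = z"
      and g: "\<And>\<zeta>. \<zeta> \<in> ball 0 r \<Longrightarrow> (g has_field_derivative f (g \<zeta>)) (at \<zeta>)"
      and op: "\<And>A. open A \<Longrightarrow> A \<subseteq> ball 0 r \<Longrightarrow> open (g ` A)"
    using complex_time_flow[OF holf fz] by metis
  define \<xi> where "\<xi> = \<i> * of_real (\<sigma> * r / 2)"
  have "g \<xi> \<in> center_region f c" if c: "is_center f c" "z \<in> frontier (center_region f c)" "\<sigma> * Im (deriv f c) > 0" for c
  proof -
    have "z \<notin> center_region f c"
      using c(2) open_center_region[OF holf c(1)] by (simp add: frontier_def interior_open)
    then have "z \<noteq> c" by (auto simp: center_region_def)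
    define N where "N = g ` ball 0 (r / 2) - {c}"
    have "ball 0 (r / 2) \<subseteq> ball (0::complex) r" using r by auto
    then have "open N" unfolding N_def by (intro open_delete op open_ball)
    moreover have "z \<in> N" using r \<open>z \<noteq> c\<close> by (force simp: N_def)
    ultimately have "center_region f c \<inter> N \<noteq> {}"
      using c(2) unfolding frontier_def by (metis DiffD1 IntI closure_iff_nhds_not_empty Int_commute order_refl)
    then obtain y where y: "y \<in> center_region f c" "y \<in> N" by blast
    then obtain \<zeta> where "\<zeta> \<in> ball 0 (r / 2)" "y = g \<zeta>" "y \<noteq> c" unfolding N_def by blast
    with y have \<zeta>: "norm \<zeta> < r / 2" "g \<zeta> \<in> center_region f c" "g \<zeta> \<noteq> c" by simp_all
    have norm_\<xi>: "norm \<xi> = r / 2" using \<sigma>(1) r by (simp add: \<xi>_def norm_mult abs_mult)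
    have "closed_segment \<zeta> \<xi> \<subseteq> ball 0 r"
      using \<zeta>(1) norm_\<xi> r by (intro closed_segment_subset) auto
    moreover have "0 \<le> Im (deriv f c) * Im (\<xi> - \<zeta>)"
    proof -
      have "\<bar>\<sigma> * Im \<zeta>\<bar> \<le> r / 2" using \<sigma>(1) \<zeta>(1) abs_Im_le_cmod[of \<zeta>] by (simp add: abs_mult)
      moreover have "\<sigma> * \<sigma> = 1" using \<sigma>(1) by (metis abs_mult_self_eq mult_1)
      moreover have "\<sigma> * Im (\<xi> - \<zeta>) = \<sigma> * \<sigma> * (r / 2) - \<sigma> * Im \<zeta>" by (simp add: \<xi>_def algebra_simps)
      ultimately have "0 \<le> \<sigma> * Im (\<xi> - \<zeta>)" by simp
      then have "0 \<le> (\<sigma> * Im (deriv f c)) * (\<sigma> * Im (\<xi> - \<zeta>))" using c(3) by simp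
      also have "\<dots> = (\<sigma> * \<sigma>) * (Im (deriv f c) * Im (\<xi> - \<zeta>))" by (simp only: mult_ac)
      finally show ?thesis using \<open>\<sigma> * \<sigma> = 1\<close> by simp
    qed
    ultimately show ?thesis using region_propagates_along_chart[OF holf c(1) g] \<zeta> by blast
  qed
  from this[OF ca z(1) \<sigma>(2)] this[OF cb z(2) \<sigma>(3)]
  show False
    using center_regions_disjoint[OF holf center_zero[OF holf ca] center_zero[OF holf cb] \<open>a \<noteq> b\<close>] by blast
qed

section \<open>Common boundary points of two regions\<close>

theorem theorem1:
  fixes f :: "complex \<Rightarrow> complex" and z0 z1 :: complex and U P0 P1 C :: "complex set"
  assumes "f holomorphic_on UNIV"
    and "z0 \<noteq> z1"
    and "is_center f z0" and "is_center f z1"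
    and "P0 = center_region f z0" and "P1 = center_region f z1"
    and "open U"
    and "C = frontier P0 \<inter> frontier P1 \<inter> U"
    and "C \<noteq> {}"
  shows "\<forall>zs \<in> U.
    zs \<in> C \<longleftrightarrow>
    (\<forall>\<^sub>F \<epsilon> in at_right (0::real).
       \<exists>w0 \<in> ball zs \<epsilon> \<inter> P0. \<exists>w1 \<in> ball zs \<epsilon> \<inter> P1.
         \<exists>\<gamma>0 \<gamma>1.
           periodic_orbit f \<gamma>0 \<and> \<gamma>0 0 = w0 \<and>
           periodic_orbit f \<gamma>1 \<and> \<gamma>1 0 = w1 \<and>
           orbit_index \<gamma>0 z0 * orbit_index \<gamma>1 z1 = -1)"
    (is "\<forall>zs\<in>U. zs \<in> C \<longleftrightarrow> (\<forall>\<^sub>F \<epsilon> in at_right 0. ?Q zs \<epsilon>)")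
proof
  fix zs assume "zs \<in> U"
  note holf = assms(1) and c0 = assms(3) and c1 = assms(4)
  have op: "open P0" "open P1"
    using open_center_region[OF holf] c0 c1 assms(5,6) by auto
  have fz: "f z0 = 0" "f z1 = 0" using center_zero[OF holf] c0 c1 by auto
  have disj: "P0 \<inter> P1 = {}"
    using center_regions_disjoint[OF holf fz assms(2)] assms(5,6) by simp
  show "zs \<in> C \<longleftrightarrow> (\<forall>\<^sub>F \<epsilon> in at_right 0. ?Q zs \<epsilon>)"
  proof
    assume "zs \<in> C"
    then have fr: "zs \<in> frontier (center_region f z0)" "zs \<in> frontier (center_region f z1)"
      using assms(5,6,8) by auto
    have opp: "sgn (Im (deriv f z0)) * sgn (Im (deriv f z1)) = -1"
      by (rule neighbouring_centers_rotate_oppositely[OF holf assms(2) c0 c1 fr])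
    have point: "\<exists>\<gamma>. periodic_orbit_around f \<gamma> c \<and> \<gamma> 0 \<in> ball zs \<epsilon> \<inter> center_region f c"
      if c: "is_center f c" "zs \<in> frontier (center_region f c)" and "\<epsilon> > 0" for c \<epsilon>
    proof -
      have "zs \<notin> center_region f c"
        using c(2) open_center_region[OF holf c(1)] by (simp add: frontier_def interior_open)
      then have "zs \<noteq> c" by (auto simp: center_region_def)
      \<comment> \<open>the bound \<open>dist zs c\<close> excludes \<open>c\<close> itself, which belongs to the region but lies on no orbit\<close>
      then have "0 < min \<epsilon> (dist zs c)" using \<open>\<epsilon> > 0\<close> by simp
      then obtain w where "w \<in> center_region f c" "dist w zs < min \<epsilon> (dist zs c)"
        using c(2) unfolding frontier_def by (metis DiffD1 closure_approachable)
      then show ?thesis by (auto simp: center_region_def dist_commute)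
    qed
    have "?Q zs \<epsilon>" if "\<epsilon> > 0" for \<epsilon>
    proof -
      obtain \<gamma>0 where 0: "periodic_orbit_around f \<gamma>0 z0" "\<gamma>0 0 \<in> ball zs \<epsilon> \<inter> P0"
        using point[OF c0 fr(1) \<open>\<epsilon> > 0\<close>] assms(5) by auto
      obtain \<gamma>1 where 1: "periodic_orbit_around f \<gamma>1 z1" "\<gamma>1 0 \<in> ball zs \<epsilon> \<inter> P1"
        using point[OF c1 fr(2) \<open>\<epsilon> > 0\<close>] assms(6) by auto
      have "orbit_index \<gamma>0 z0 * orbit_index \<gamma>1 z1 = of_real (sgn (Im (deriv f z0)) * sgn (Im (deriv f z1)))"
        using enclosed_zero_multiplier(3)[OF holf 0(1) fz(1)] enclosed_zero_multiplier(3)[OF holf 1(1) fz(2)] by simp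
      then have "orbit_index \<gamma>0 z0 * orbit_index \<gamma>1 z1 = -1" unfolding opp by simp
      moreover have "periodic_orbit f \<gamma>0" "periodic_orbit f \<gamma>1"
        using 0(1) 1(1) by (auto simp: periodic_orbit_around_def)
      ultimately show ?thesis using 0(2) 1(2) by blast
    qed
    then show "\<forall>\<^sub>F \<epsilon> in at_right 0. ?Q zs \<epsilon>"
      by (auto simp: eventually_at_right_field intro!: exI[of _ 1])
  next
    assume "\<forall>\<^sub>F \<epsilon> in at_right 0. ?Q zs \<epsilon>"
    then obtain b where b: "b > 0" "\<And>\<epsilon>. 0 < \<epsilon> \<Longrightarrow> \<epsilon> < b \<Longrightarrow> ?Q zs \<epsilon>"
      by (auto simp: eventually_at_right_field)
    have "\<exists>w0\<in>P0. dist w0 zs < e" "\<exists>w1\<in>P1. dist w1 zs < e" if "e > 0" for e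
    proof -
      have "0 < min e (b / 2)" "min e (b / 2) < b" using b(1) that by auto
      from b(2)[OF this] show "\<exists>w0\<in>P0. dist w0 zs < e" "\<exists>w1\<in>P1. dist w1 zs < e"
        by (auto simp: dist_commute)
    qed
    then have cl: "zs \<in> closure P0" "zs \<in> closure P1" by (auto simp: closure_approachable)
    have "zs \<notin> P0" "zs \<notin> P1"
      using cl op disj open_Int_closure_eq_empty[of P0 P1] open_Int_closure_eq_empty[of P1 P0] by blast+
    then show "zs \<in> C"
      using cl op \<open>zs \<in> U\<close> assms(8) by (simp add: frontier_def interior_open)
  qed
qed

end
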